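(* Let $p$ be a prime, $1<r<\infty$ and $\alpha>0$, and let the $p$-adic Hardy-Littlewood-Pólya operator be defined by $$\mathscr{P}^pf(x)=\int_{\mathbb{Q}_p^*}\frac{f(y)}{\max\{|x|_p,|y|_p\}}\,dy,\qquad x\in\mathbb{Q}_p^*.$$ If $0<1/r+\alpha<1$, then there is a constant $C>0$ such that for any $f\in\mathfrak{B}_{r,\alpha}(\mathbb{Q}_p^* )$, $$\|\mathscr{P}^pf\|_{\mathfrak{B}_{r,\alpha}(\mathbb{Q}_p^* )}\le C\,\|f\|_{\mathfrak{B}_{r,\alpha}(\mathbb{Q}_p^* )}.$$
   Context: $\mathbb{Q}_p$ is the field of $p$-adic numbers with absolute value $|\cdot|_p$, and $\mathbb{Q}_p^*=\mathbb{Q}_p\setminus\{0\}$. $dx$ is the Haar measure on the additive group $\mathbb{Q}_p$ normalized so that $\{|x|_p\le1\}$ has measure $1$, and $|E|$ denotes the Haar measure of $E$. For $n\in\mathbb{Z}$, $B^n=\{x\in\mathbb{Q}_p:|x|_p\le p^n\}$, so $|B^n|=p^n$. A function $a:\mathbb{Q}_p^*\to\mathbb{C}$ is a central $(r,\alpha)$-block if there exists $n\in\mathbb{Z}$ such that $\operatorname{supp}a\subset B^n$ and $\|a\|_{L^r}\le|B^n|^{-\alpha}$. The block space $\mathfrak{B}_{r,\alpha}(\mathbb{Q}_p^* )$ is the set of all $f\in L^r_{\mathrm{loc}}(\mathbb{Q}_p^* )$ that can be written as $f=\sum_{k=1}^\infty\lambda_ka_k$ (almost everywhere) with scalars $\lambda_k$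 satisfying $\sum_k|\lambda_k|<\infty$ and each $a_k$ a central $(r,\alpha)$-block; its norm is $\|f\|_{\mathfrak{B}_{r,\alpha}(\mathbb{Q}_p^* )}=\inf\sum_{k=1}^\infty|\lambda_k|$, the infimum being over all such decompositions of $f$. *)

theory Defs
  imports "HOL-Analysis.Analysis" "Berlekamp_Zassenhaus.Finite_Field"
begin

text \<open>
  The field \<open>'p padic\<close> is the completion of the rationals for the \<open>p\<close>-adic absolute value, as
  equivalence classes of Cauchy sequences. The prime is \<open>p = CARD('p)\<close>; every prime is the
  cardinality of some type of class \<open>prime_card\<close>.
\<close>

definition rat_padic_val :: "nat \<Rightarrow> rat \<Rightarrow> int" where
  "rat_padic_val p q =
     int (multiplicity (int p) (fst (quotient_of q))) - int (multiplicity (int p) (snd (quotient_of q)))"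

definition rat_padic_abs :: "nat \<Rightarrow> rat \<Rightarrow> real" where
  "rat_padic_abs p q = (if q = 0 then 0 else real p powi (- rat_padic_val p q))"

definition rat_padic_Cauchy :: "nat \<Rightarrow> (nat \<Rightarrow> rat) \<Rightarrow> bool" where
  "rat_padic_Cauchy p X \<longleftrightarrow>
     (\<forall>e>0. \<exists>N. \<forall>m\<ge>N. \<forall>n\<ge>N. rat_padic_abs p (X m - X n) < e)"

definition rat_padic_null :: "nat \<Rightarrow> (nat \<Rightarrow> rat) \<Rightarrow> bool" where
  "rat_padic_null p X \<longleftrightarrow> (\<lambda>n. rat_padic_abs p (X n)) \<longlonglongrightarrow> 0"

lemma rat_padic_val_divide:
  assumes "prime p" "a \<noteq> 0" "b \<noteq> 0"
  shows "rat_padic_val p (of_int a / of_int b)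
           = int (multiplicity (int p) a) - int (multiplicity (int p) b)"
proof -
  define q :: rat where "q = of_int a / of_int b"
  obtain c d where cd: "quotient_of q = (c, d)" by fastforce
  have d: "d > 0" "q = of_int c / of_int d"
    using quotient_of_denom_pos[OF cd] quotient_of_div[OF cd] by auto
  have c: "c \<noteq> 0" using d assms by (auto simp: q_def)
  have "(of_int (a * d) :: rat) = of_int (c * b)"
    using d assms by (simp add: q_def field_simps)
  hence eq: "a * d = c * b" by (simp only: of_int_eq_iff)
  have pe: "prime_elem (int p)" using assms by simp
  have "multiplicity (int p) a + multiplicity (int p) d = multiplicity (int p) c + multiplicity (int p) b"
    using arg_cong[OF eq, of "multiplicity (int p)"] assms d c
    by (simp add: prime_elem_multiplicity_mult_distrib[OF pe])
  thus ?thesis unfolding rat_padic_val_def q_def[symmetric] cd by simp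
qed

context
  fixes p :: nat
  assumes p: "prime p"
begin

lemma rat_padic_abs_0 [simp]: "rat_padic_abs p 0 = 0"
  by (simp add: rat_padic_abs_def)

lemma rat_padic_abs_nonneg: "rat_padic_abs p x \<ge> 0"
  by (simp add: rat_padic_abs_def)

lemma rat_padic_abs_eq_0_iff: "rat_padic_abs p x = 0 \<longleftrightarrow> x = 0"
  using p by (auto simp: rat_padic_abs_def dest: prime_gt_0_nat)

lemma rat_padic_abs_frac:
  assumes "a \<noteq> 0" "b \<noteq> 0"
  shows "rat_padic_abs p (of_int a / of_int b)
           = real p powi (int (multiplicity (int p) b) - int (multiplicity (int p) a))"
  using assms by (simp add: rat_padic_abs_def rat_padic_val_divide[OF p])

lemma rat_frac_cases:
  obtains a b :: int where "x = (of_int a / of_int b :: rat)" "b > 0"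
  by (metis quotient_of_denom_pos quotient_of_div surj_pair)

lemma rat_padic_abs_mult: "rat_padic_abs p (x * y) = rat_padic_abs p x * rat_padic_abs p y"
proof (cases "x = 0 \<or> y = 0")
  case False
  obtain a b where x: "x = of_int a / of_int b" "b > 0" by (rule rat_frac_cases)
  obtain c d where y: "y = of_int c / of_int d" "d > 0" by (rule rat_frac_cases)
  have nz: "a \<noteq> 0" "c \<noteq> 0" "b \<noteq> 0" "d \<noteq> 0" using False x y by auto
  have pe: "prime_elem (int p)" using p by simp
  have xy: "x * y = of_int (a * c) / of_int (b * d)" using x y by simp
  have p0: "real p \<noteq> 0" using p by (auto dest: prime_gt_0_nat)
  show ?thesis
    unfolding xy rat_padic_abs_frac[OF nz(1,3), folded x(1)] rat_padic_abs_frac[OF nz(2,4), folded y(1)]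
    using nz p0
    by (subst rat_padic_abs_frac)
       (auto simp: prime_elem_multiplicity_mult_distrib[OF pe] power_int_add[symmetric] algebra_simps)
qed auto

lemma rat_padic_abs_1 [simp]: "rat_padic_abs p 1 = 1"
  using rat_padic_abs_frac[of 1 1] by simp

lemma rat_padic_abs_minus [simp]: "rat_padic_abs p (- x) = rat_padic_abs p x"
proof -
  have "rat_padic_abs p (-1) = 1"
    using rat_padic_abs_frac[of "-1" 1] multiplicity_unit_right[of "-1::int" "int p"] by simp
  thus ?thesis using rat_padic_abs_mult[of "-1" x] by simp
qed

lemma rat_padic_abs_diff_commute: "rat_padic_abs p (x - y) = rat_padic_abs p (y - x)"
  using rat_padic_abs_minus[of "x - y"] by simp

lemma rat_padic_abs_inverse: "rat_padic_abs p (inverse x) = inverse (rat_padic_abs p x)"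
proof (cases "x = 0")
  case False
  hence "rat_padic_abs p (inverse x) * rat_padic_abs p x = 1"
    by (subst rat_padic_abs_mult[symmetric]) auto
  thus ?thesis using inverse_unique[of "rat_padic_abs p x"] by (metis mult.commute)
qed auto

lemma rat_padic_abs_add: "rat_padic_abs p (x + y) \<le> max (rat_padic_abs p x) (rat_padic_abs p y)"
proof (cases "x = 0 \<or> y = 0 \<or> x + y = 0")
  case True
  thus ?thesis using rat_padic_abs_nonneg by (auto simp: le_max_iff_disj)
next
  case False
  obtain a b where x: "x = of_int a / of_int b" "b > 0" by (rule rat_frac_cases)
  obtain c d where y: "y = of_int c / of_int d" "d > 0" by (rule rat_frac_cases)
  define v where "v = multiplicity (int p)"
  have nz: "a \<noteq> 0" "c \<noteq> 0" "b \<noteq> 0" "d \<noteq> 0" using False x y by auto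
  have pe: "prime_elem (int p)" using p by simp
  have xy: "x + y = of_int (a * d + c * b) / of_int (b * d)" using x y by (simp add: field_simps)
  have snz: "a * d + c * b \<noteq> 0" using False unfolding xy by (metis div_0 of_int_0)
  have vm: "v (s * t) = v s + v t" if "s \<noteq> 0" "t \<noteq> 0" for s t
    unfolding v_def using prime_elem_multiplicity_mult_distrib[OF pe that] .
  define k where "k = min (v (a * d)) (v (c * b))"
  have "int p ^ k dvd a * d" "int p ^ k dvd c * b"
    unfolding v_def k_def by (auto intro!: multiplicity_dvd')
  hence "int p ^ k dvd a * d + c * b" by (rule dvd_add)
  hence vk: "k \<le> v (a * d + c * b)"
    unfolding v_def using snz p by (intro multiplicity_geI) auto
  have p1: "real p \<ge> 1" using p by (auto dest: prime_gt_0_nat)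
  have X: "rat_padic_abs p x = real p powi (int (v (b * d)) - int (v (a * d)))"
    unfolding x using nz by (subst rat_padic_abs_frac) (auto simp: vm, simp add: v_def)
  have Y: "rat_padic_abs p y = real p powi (int (v (b * d)) - int (v (c * b)))"
    unfolding y using nz by (subst rat_padic_abs_frac) (auto simp: vm, simp add: v_def)
  have XY: "rat_padic_abs p (x + y) = real p powi (int (v (b * d)) - int (v (a * d + c * b)))"
    unfolding xy using nz snz by (subst rat_padic_abs_frac) (auto simp: v_def)
  consider "v (a * d) \<le> v (a * d + c * b)" | "v (c * b) \<le> v (a * d + c * b)"
    using vk unfolding k_def by linarith
  thus ?thesis
    unfolding le_max_iff_disj X Y XY using p1
    by cases (auto intro!: power_int_increasing)
qed

lemma rat_padic_abs_add_le: "rat_padic_abs p (x + y) \<le> rat_padic_abs p x + rat_padic_abs p y"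
  using rat_padic_abs_add[of x y] rat_padic_abs_nonneg[of x] rat_padic_abs_nonneg[of y] by linarith

lemma rat_padic_abs_diff_le: "\<bar>rat_padic_abs p x - rat_padic_abs p y\<bar> \<le> rat_padic_abs p (x - y)"
  using rat_padic_abs_add_le[of "x - y" y] rat_padic_abs_add_le[of "y - x" x]
  by (simp add: rat_padic_abs_diff_commute)

lemma rat_padic_null_add:
  assumes "rat_padic_null p X" "rat_padic_null p Y"
  shows "rat_padic_null p (\<lambda>n. X n + Y n)"
  unfolding rat_padic_null_def
proof (rule tendsto_sandwich[OF _ _ tendsto_const])
  show "(\<lambda>n. rat_padic_abs p (X n) + rat_padic_abs p (Y n)) \<longlonglongrightarrow> 0"
    using tendsto_add[OF assms[unfolded rat_padic_null_def]] by simp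
qed (auto simp: rat_padic_abs_nonneg rat_padic_abs_add_le)

lemma rat_padic_null_minus: "rat_padic_null p X \<Longrightarrow> rat_padic_null p (\<lambda>n. - X n)"
  by (simp add: rat_padic_null_def)

lemma rat_padic_null_diff:
  assumes "rat_padic_null p X" "rat_padic_null p Y"
  shows "rat_padic_null p (\<lambda>n. X n - Y n)"
  using rat_padic_null_add[OF assms(1) rat_padic_null_minus[OF assms(2)]] by simp

lemma rat_padic_null_commute: "rat_padic_null p (\<lambda>n. X n - Y n) \<longleftrightarrow> rat_padic_null p (\<lambda>n. Y n - X n)"
  by (simp add: rat_padic_null_def rat_padic_abs_diff_commute)

lemma rat_padic_null_0: "rat_padic_null p (\<lambda>n. 0)"
  by (simp add: rat_padic_null_def)

lemma rat_padic_Cauchy_const: "rat_padic_Cauchy p (\<lambda>n. c)"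
  by (simp add: rat_padic_Cauchy_def)

lemma rat_padic_Cauchy_minus: "rat_padic_Cauchy p X \<Longrightarrow> rat_padic_Cauchy p (\<lambda>n. - X n)"
  unfolding rat_padic_Cauchy_def by (simp add: rat_padic_abs_diff_commute)

lemma rat_padic_Cauchy_add:
  assumes "rat_padic_Cauchy p X" "rat_padic_Cauchy p Y"
  shows "rat_padic_Cauchy p (\<lambda>n. X n + Y n)"
  unfolding rat_padic_Cauchy_def
proof (intro allI impI)
  fix e :: real assume e: "e > 0"
  obtain M where M: "\<And>m n. m \<ge> M \<Longrightarrow> n \<ge> M \<Longrightarrow> rat_padic_abs p (X m - X n) < e"
    using assms(1) e unfolding rat_padic_Cauchy_def by meson
  obtain N where N: "\<And>m n. m \<ge> N \<Longrightarrow> n \<ge> N \<Longrightarrow> rat_padic_abs p (Y m - Y n) < e"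
    using assms(2) e unfolding rat_padic_Cauchy_def by meson
  have "rat_padic_abs p (X m + Y m - (X n + Y n)) < e" if "m \<ge> max M N" "n \<ge> max M N" for m n
    using rat_padic_abs_add[of "X m - X n" "Y m - Y n"] M[of m n] N[of m n] that
    by (simp add: add_diff_add)
  thus "\<exists>N. \<forall>m\<ge>N. \<forall>n\<ge>N. rat_padic_abs p (X m + Y m - (X n + Y n)) < e" by blast
qed

lemma rat_padic_Cauchy_convergent:
  assumes "rat_padic_Cauchy p X"
  shows "convergent (\<lambda>n. rat_padic_abs p (X n))"
proof -
  have "Cauchy (\<lambda>n. rat_padic_abs p (X n))"
    unfolding Cauchy_def dist_real_def
    using assms unfolding rat_padic_Cauchy_def
    by (meson rat_padic_abs_diff_le le_less_trans)
  thus ?thesis by (rule Cauchy_convergent)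
qed

lemma rat_padic_Cauchy_bounded:
  assumes "rat_padic_Cauchy p X"
  obtains B where "B > 0" "\<And>n. rat_padic_abs p (X n) < B"
proof -
  have "Bseq (\<lambda>n. rat_padic_abs p (X n))"
    using rat_padic_Cauchy_convergent[OF assms] by (rule convergent_imp_Bseq)
  then obtain K where K: "K > 0" "\<And>n. norm (rat_padic_abs p (X n)) \<le> K"
    by (rule BseqE) auto
  show ?thesis
  proof (rule that[of "K + 1"])
    show "rat_padic_abs p (X n) < K + 1" for n using K(2)[of n] by simp
  qed (use K in auto)
qed

lemma rat_padic_Cauchy_mult:
  assumes "rat_padic_Cauchy p X" "rat_padic_Cauchy p Y"
  shows "rat_padic_Cauchy p (\<lambda>n. X n * Y n)"
  unfolding rat_padic_Cauchy_def
proof (intro allI impI)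
  fix e :: real assume e: "e > 0"
  obtain A where A: "A > 0" "\<And>n. rat_padic_abs p (X n) < A" using rat_padic_Cauchy_bounded[OF assms(1)] by blast
  obtain B where B: "B > 0" "\<And>n. rat_padic_abs p (Y n) < B" using rat_padic_Cauchy_bounded[OF assms(2)] by blast
  have eB: "e / B > 0" and eA: "e / A > 0" using e A B by auto
  obtain M where M: "\<And>m n. m \<ge> M \<Longrightarrow> n \<ge> M \<Longrightarrow> rat_padic_abs p (X m - X n) < e / B"
    using assms(1) eB unfolding rat_padic_Cauchy_def by meson
  obtain N where N: "\<And>m n. m \<ge> N \<Longrightarrow> n \<ge> N \<Longrightarrow> rat_padic_abs p (Y m - Y n) < e / A"
    using assms(2) eA unfolding rat_padic_Cauchy_def by meson
  have "rat_padic_abs p (X m * Y m - X n * Y n) < e" if mn: "m \<ge> max M N" "n \<ge> max M N" for m n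
  proof -
    have "rat_padic_abs p (X m * (Y m - Y n)) < A * (e / A)"
      unfolding rat_padic_abs_mult using A N mn
      by (intro mult_strict_mono') (auto simp: rat_padic_abs_nonneg)
    moreover have "rat_padic_abs p ((X m - X n) * Y n) < (e / B) * B"
      unfolding rat_padic_abs_mult using B M mn
      by (intro mult_strict_mono') (auto simp: rat_padic_abs_nonneg)
    ultimately show ?thesis
      using rat_padic_abs_add[of "X m * (Y m - Y n)" "(X m - X n) * Y n"] A B
      by (simp add: mult_diff_mult)
  qed
  thus "\<exists>N. \<forall>m\<ge>N. \<forall>n\<ge>N. rat_padic_abs p (X m * Y m - X n * Y n) < e" by blast
qed

lemma rat_padic_null_mult:
  assumes "rat_padic_null p X" "rat_padic_Cauchy p Y"
  shows "rat_padic_null p (\<lambda>n. X n * Y n)"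
proof -
  obtain B where B: "B > 0" "\<And>n. rat_padic_abs p (Y n) < B" using rat_padic_Cauchy_bounded[OF assms(2)] by blast
  show ?thesis unfolding rat_padic_null_def rat_padic_abs_mult
  proof (rule tendsto_sandwich[OF _ _ tendsto_const])
    show "(\<lambda>n. rat_padic_abs p (X n) * B) \<longlonglongrightarrow> 0"
      using tendsto_mult_right[OF assms(1)[unfolded rat_padic_null_def], of B] by simp
  qed (use B in \<open>auto simp: rat_padic_abs_nonneg intro!: always_eventually mult_left_mono less_imp_le[OF B(2)]\<close>)
qed

lemma rat_padic_Cauchy_not_null:
  assumes "rat_padic_Cauchy p X" "\<not> rat_padic_null p X"
  obtains b where "b > 0" "\<forall>\<^sub>F n in sequentially. rat_padic_abs p (X n) > b"
proof -
  obtain L where L: "(\<lambda>n. rat_padic_abs p (X n)) \<longlonglongrightarrow> L"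
    using rat_padic_Cauchy_convergent[OF assms(1)] by (auto simp: convergent_def)
  have "L \<ge> 0" using L by (rule LIMSEQ_le_const) (auto simp: rat_padic_abs_nonneg)
  moreover have "L \<noteq> 0" using L assms(2) by (auto simp: rat_padic_null_def)
  ultimately have L0: "L > 0" by simp
  show ?thesis
    by (rule that[of "L / 2"]) (use L0 order_tendstoD(1)[OF L, of "L / 2"] in auto)
qed

lemma rat_padic_Cauchy_inverse:
  assumes "rat_padic_Cauchy p X" "\<not> rat_padic_null p X"
  shows "rat_padic_Cauchy p (\<lambda>n. inverse (X n))"
  unfolding rat_padic_Cauchy_def
proof (intro allI impI)
  fix e :: real assume e: "e > 0"
  obtain b where b: "b > 0" "\<forall>\<^sub>F n in sequentially. rat_padic_abs p (X n) > b"
    using rat_padic_Cauchy_not_null[OF assms] .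
  obtain K where K: "\<And>n. n \<ge> K \<Longrightarrow> rat_padic_abs p (X n) > b"
    using b(2) unfolding eventually_sequentially by blast
  have "b * e * b > 0" using b e by simp
  then obtain M where M: "\<And>m n. m \<ge> M \<Longrightarrow> n \<ge> M \<Longrightarrow> rat_padic_abs p (X m - X n) < b * e * b"
    using assms(1) unfolding rat_padic_Cauchy_def by meson
  have "rat_padic_abs p (inverse (X m) - inverse (X n)) < e" if mn: "m \<ge> max K M" "n \<ge> max K M" for m n
  proof -
    have gt: "rat_padic_abs p (X m) > b" "rat_padic_abs p (X n) > b" using K mn by auto
    hence nz: "X m \<noteq> 0" "X n \<noteq> 0" using b by auto
    have "rat_padic_abs p (inverse (X m) - inverse (X n))
        = rat_padic_abs p (X m - X n) / (rat_padic_abs p (X m) * rat_padic_abs p (X n))"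
      unfolding inverse_diff_inverse[OF nz] rat_padic_abs_minus rat_padic_abs_mult rat_padic_abs_inverse
      by (simp add: field_simps)
    also have "\<dots> \<le> rat_padic_abs p (X m - X n) / (b * b)"
      using gt b by (intro divide_left_mono mult_mono) (auto simp: rat_padic_abs_nonneg intro!: mult_pos_pos)
    also have "\<dots> < e" using M[of m n] mn b by (simp add: field_simps)
    finally show ?thesis .
  qed
  thus "\<exists>N. \<forall>m\<ge>N. \<forall>n\<ge>N. rat_padic_abs p (inverse (X m) - inverse (X n)) < e" by blast
qed

lemma rat_padic_null_diff_inverse:
  assumes "rat_padic_Cauchy p X" "\<not> rat_padic_null p X"
  assumes "rat_padic_Cauchy p Y" "\<not> rat_padic_null p Y"
  assumes "rat_padic_null p (\<lambda>n. X n - Y n)"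
  shows "rat_padic_null p (\<lambda>n. inverse (X n) - inverse (Y n))"
proof -
  obtain b where b: "b > 0" "\<forall>\<^sub>F n in sequentially. rat_padic_abs p (X n) > b"
    using rat_padic_Cauchy_not_null[OF assms(1,2)] .
  obtain c where c: "c > 0" "\<forall>\<^sub>F n in sequentially. rat_padic_abs p (Y n) > c"
    using rat_padic_Cauchy_not_null[OF assms(3,4)] .
  have "rat_padic_null p (\<lambda>n. (X n - Y n) * (- (inverse (X n) * inverse (Y n))))"
    using assms by (intro rat_padic_null_mult rat_padic_Cauchy_minus rat_padic_Cauchy_mult rat_padic_Cauchy_inverse)
  moreover have "\<forall>\<^sub>F n in sequentially. (X n - Y n) * (- (inverse (X n) * inverse (Y n))) = inverse (X n) - inverse (Y n)"
    using b(2) c(2)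
  proof eventually_elim
    case (elim n)
    hence "X n \<noteq> 0" "Y n \<noteq> 0" using b c by auto
    thus ?case by (simp add: inverse_diff_inverse)
  qed
  hence "\<forall>\<^sub>F n in sequentially. rat_padic_abs p ((X n - Y n) * (- (inverse (X n) * inverse (Y n))))
           = rat_padic_abs p (inverse (X n) - inverse (Y n))"
    by (rule eventually_mono) (rule arg_cong)
  ultimately show ?thesis unfolding rat_padic_null_def
    by (rule Lim_transform_eventually)
qed

end

typedef (overloaded) 'p padic_seq = "{X. rat_padic_Cauchy CARD('p::prime_card) X}"
  by (rule exI[of _ "\<lambda>_. 0"]) (simp add: rat_padic_Cauchy_const[OF prime_card])

setup_lifting type_definition_padic_seq

instantiation padic_seq :: (prime_card) comm_ring_1
begin

lift_definition zero_padic_seq :: "'a padic_seq" is "\<lambda>_. 0"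
  by (rule rat_padic_Cauchy_const[OF prime_card])
lift_definition one_padic_seq :: "'a padic_seq" is "\<lambda>_. 1"
  by (rule rat_padic_Cauchy_const[OF prime_card])
lift_definition plus_padic_seq :: "'a padic_seq \<Rightarrow> 'a padic_seq \<Rightarrow> 'a padic_seq" is "\<lambda>X Y n. X n + Y n"
  by (rule rat_padic_Cauchy_add[OF prime_card])
lift_definition uminus_padic_seq :: "'a padic_seq \<Rightarrow> 'a padic_seq" is "\<lambda>X n. - X n"
  by (rule rat_padic_Cauchy_minus[OF prime_card])
lift_definition minus_padic_seq :: "'a padic_seq \<Rightarrow> 'a padic_seq \<Rightarrow> 'a padic_seq" is "\<lambda>X Y n. X n - Y n"
  using rat_padic_Cauchy_add[OF prime_card _ rat_padic_Cauchy_minus[OF prime_card]] by force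
lift_definition times_padic_seq :: "'a padic_seq \<Rightarrow> 'a padic_seq \<Rightarrow> 'a padic_seq" is "\<lambda>X Y n. X n * Y n"
  by (rule rat_padic_Cauchy_mult[OF prime_card])

instance
  by standard (transfer; simp add: fun_eq_iff algebra_simps)+

end

lift_definition padic_seq_null :: "'p::prime_card padic_seq \<Rightarrow> bool" is "rat_padic_null CARD('p)" .

lift_definition padic_seq_inverse :: "'p::prime_card padic_seq \<Rightarrow> 'p padic_seq" is
  "\<lambda>X. if rat_padic_null CARD('p) X then (\<lambda>_. 0) else (\<lambda>n. inverse (X n))"
  by (auto simp: rat_padic_Cauchy_const[OF prime_card] rat_padic_Cauchy_inverse[OF prime_card])

lift_definition padic_seq_norm :: "'p::prime_card padic_seq \<Rightarrow> real" is
  "\<lambda>X. lim (\<lambda>n. rat_padic_abs CARD('p) (X n))" .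

lemma padic_seq_null_0: "padic_seq_null 0"
  by transfer (rule rat_padic_null_0[OF prime_card])

lemma padic_seq_null_add: "padic_seq_null X \<Longrightarrow> padic_seq_null Y \<Longrightarrow> padic_seq_null (X + Y)"
  by transfer (rule rat_padic_null_add[OF prime_card])

lemma padic_seq_null_minus: "padic_seq_null X \<Longrightarrow> padic_seq_null (- X)"
  by transfer (rule rat_padic_null_minus[OF prime_card])

lemma padic_seq_null_mult: "padic_seq_null X \<Longrightarrow> padic_seq_null (X * Y)"
  by transfer (rule rat_padic_null_mult[OF prime_card])

lemma padic_seq_null_mult_left: "padic_seq_null X \<Longrightarrow> padic_seq_null (Y * X)"
  using padic_seq_null_mult[of X Y] by (simp add: mult.commute)

lemma padic_seq_null_cong:
  assumes "padic_seq_null (X - Y)" shows "padic_seq_null X \<longleftrightarrow> padic_seq_null Y"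
  using padic_seq_null_add[OF assms, of Y] padic_seq_null_add[OF padic_seq_null_minus[OF assms], of X]
  by auto

lemma padic_seq_null_diff_inverse:
  assumes "padic_seq_null (X - Y)"
  shows "padic_seq_null (padic_seq_inverse X - padic_seq_inverse Y)"
proof (cases "padic_seq_null X")
  case True
  with padic_seq_null_cong[OF assms] have "padic_seq_null Y" by simp
  with True show ?thesis
    by transfer (simp add: rat_padic_null_0[OF prime_card])
next
  case False
  with padic_seq_null_cong[OF assms] have "\<not> padic_seq_null Y" by simp
  with False assms show ?thesis
    by transfer (simp add: rat_padic_null_diff_inverse[OF prime_card])
qed

lemma padic_seq_norm_tendsto:
  fixes X :: "'p::prime_card padic_seq"
  shows "(\<lambda>n. rat_padic_abs CARD('p) (Rep_padic_seq X n)) \<longlonglongrightarrow> padic_seq_norm X"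
  using rat_padic_Cauchy_convergent[OF prime_card] Rep_padic_seq[of X]
  by (auto simp: padic_seq_norm.rep_eq convergent_LIMSEQ_iff)

lemma padic_seq_norm_cong:
  fixes X Y :: "'p::prime_card padic_seq"
  assumes "padic_seq_null (X - Y)" shows "padic_seq_norm X = padic_seq_norm Y"
proof -
  let ?N = "rat_padic_abs CARD('p)"
  have "(\<lambda>n. ?N (Rep_padic_seq X n) - ?N (Rep_padic_seq Y n)) \<longlonglongrightarrow> 0"
  proof (rule tendsto_rabs_zero_cancel, rule tendsto_sandwich[OF _ _ tendsto_const])
    show "(\<lambda>n. ?N (Rep_padic_seq X n - Rep_padic_seq Y n)) \<longlonglongrightarrow> 0"
      using assms by (simp add: padic_seq_null.rep_eq minus_padic_seq.rep_eq rat_padic_null_def)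
  qed (auto simp: rat_padic_abs_diff_le[OF prime_card])
  from LIMSEQ_unique[OF this tendsto_diff[OF padic_seq_norm_tendsto padic_seq_norm_tendsto]]
  show ?thesis by simp
qed

lemma padic_seq_norm_eq_0_iff: "padic_seq_norm X = 0 \<longleftrightarrow> padic_seq_null X"
  for X :: "'p::prime_card padic_seq"
  using padic_seq_norm_tendsto[of X] LIMSEQ_unique[OF padic_seq_norm_tendsto[of X], of 0]
  by (auto simp: padic_seq_null.rep_eq rat_padic_null_def)

lemma padic_seq_null_mult_inverse:
  assumes "\<not> padic_seq_null X" shows "padic_seq_null (padic_seq_inverse X * X - 1)"
  using assms
proof transfer
  fix X :: "nat \<Rightarrow> rat" assume X: "rat_padic_Cauchy CARD('a) X" "\<not> rat_padic_null CARD('a) X"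
  obtain b where b: "b > 0" "\<forall>\<^sub>F n in sequentially. rat_padic_abs CARD('a) (X n) > b"
    using rat_padic_Cauchy_not_null[OF prime_card X] .
  have "\<forall>\<^sub>F n in sequentially. 0 = rat_padic_abs CARD('a) (inverse (X n) * X n - 1)"
    using b(2)
  proof eventually_elim
    case (elim n)
    hence "X n \<noteq> 0" using b(1) by (auto simp: rat_padic_abs_0[OF prime_card])
    thus ?case by (simp add: rat_padic_abs_0[OF prime_card])
  qed
  hence "rat_padic_null CARD('a) (\<lambda>n. inverse (X n) * X n - 1)"
    unfolding rat_padic_null_def by (rule Lim_transform_eventually[OF tendsto_const])
  thus "rat_padic_null CARD('a) (\<lambda>n. (if rat_padic_null CARD('a) X then \<lambda>_. 0 else (\<lambda>n. inverse (X n))) n * X n - 1)"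
    using X by simp
qed

quotient_type (overloaded) 'p padic = "'p::prime_card padic_seq" / "\<lambda>X Y. padic_seq_null (X - Y)"
proof (rule equivpI)
  show "reflp (\<lambda>X Y::'p padic_seq. padic_seq_null (X - Y))"
    by (intro reflpI) (simp add: padic_seq_null_0)
  show "symp (\<lambda>X Y::'p padic_seq. padic_seq_null (X - Y))"
    by (intro sympI) (metis minus_diff_eq padic_seq_null_minus)
  show "transp (\<lambda>X Y::'p padic_seq. padic_seq_null (X - Y))"
    by (intro transpI) (metis diff_add_cancel add_diff_eq padic_seq_null_add)
qed

instantiation padic :: (prime_card) field
begin

lift_definition zero_padic :: "'a padic" is 0 .
lift_definition one_padic :: "'a padic" is 1 .
lift_definition plus_padic :: "'a padic \<Rightarrow> 'a padic \<Rightarrow> 'a padic" is "(+)"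
  by (simp only: add_diff_add padic_seq_null_add)
lift_definition uminus_padic :: "'a padic \<Rightarrow> 'a padic" is uminus
  by (simp only: minus_diff_minus padic_seq_null_minus)
lift_definition times_padic :: "'a padic \<Rightarrow> 'a padic \<Rightarrow> 'a padic" is "(*)"
  by (simp only: mult_diff_mult padic_seq_null_add padic_seq_null_mult padic_seq_null_mult_left)
lift_definition inverse_padic :: "'a padic \<Rightarrow> 'a padic" is padic_seq_inverse
  by (rule padic_seq_null_diff_inverse)
definition minus_padic :: "'a padic \<Rightarrow> 'a padic \<Rightarrow> 'a padic" where
  "minus_padic x y = x + - y"
definition divide_padic :: "'a padic \<Rightarrow> 'a padic \<Rightarrow> 'a padic" where
  "divide_padic x y = x * inverse y"

instance
proof
  fix a b c :: "'a padic"
  show "a + b + c = a + (b + c)" by transfer (simp add: padic_seq_null_0 algebra_simps)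
  show "a + b = b + a" by transfer (simp add: padic_seq_null_0 algebra_simps)
  show "0 + a = a" by transfer (simp add: padic_seq_null_0)
  show "- a + a = 0" by transfer (simp add: padic_seq_null_0)
  show "a - b = a + - b" by (rule minus_padic_def)
  show "a * b * c = a * (b * c)" by transfer (simp add: padic_seq_null_0 algebra_simps)
  show "a * b = b * a" by transfer (simp add: padic_seq_null_0 algebra_simps)
  show "1 * a = a" by transfer (simp add: padic_seq_null_0)
  show "(a + b) * c = a * c + b * c" by transfer (simp add: padic_seq_null_0 algebra_simps)
  show "a \<noteq> 0 \<Longrightarrow> inverse a * a = 1" by transfer (simp add: padic_seq_null_mult_inverse)
  show "a div b = a * inverse b" by (rule divide_padic_def)
  have "padic_seq_null (padic_seq_inverse 0 - (0 :: 'a padic_seq))"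
    by transfer (simp add: rat_padic_null_0[OF prime_card])
  thus "inverse (0::'a padic) = 0" by transfer
  have "\<not> padic_seq_null (0 - (1 :: 'a padic_seq))"
    by transfer (simp add: rat_padic_null_def rat_padic_abs_minus[OF prime_card] rat_padic_abs_1[OF prime_card] LIMSEQ_const_iff)
  thus "(0::'a padic) \<noteq> 1" by transfer
qed

end

lift_definition padic_norm :: "'p::prime_card padic \<Rightarrow> real" is padic_seq_norm
  by (rule padic_seq_norm_cong)

lemma padic_norm_eq_0_iff [simp]: "padic_norm x = 0 \<longleftrightarrow> x = 0"
  by transfer (simp add: padic_seq_norm_eq_0_iff)

lemma padic_norm_0 [simp]: "padic_norm 0 = 0"
  by simp

lemma padic_norm_nonneg [simp]: "padic_norm x \<ge> 0"
proof transfer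
  show "padic_seq_norm X \<ge> 0" for X :: "'a padic_seq"
    by (rule LIMSEQ_le_const[OF padic_seq_norm_tendsto]) (auto simp: rat_padic_abs_nonneg[OF prime_card])
qed

lemma padic_norm_mult: "padic_norm (x * y) = padic_norm x * padic_norm y"
proof transfer
  fix X Y :: "'a padic_seq"
  show "padic_seq_norm (X * Y) = padic_seq_norm X * padic_seq_norm Y"
    using padic_seq_norm_tendsto[of "X * Y"] tendsto_mult[OF padic_seq_norm_tendsto[of X] padic_seq_norm_tendsto[of Y]]
    by (auto simp: times_padic_seq.rep_eq rat_padic_abs_mult[OF prime_card] intro: LIMSEQ_unique)
qed

lemma padic_norm_minus [simp]: "padic_norm (- x) = padic_norm x"
proof transfer
  show "padic_seq_norm (- X) = padic_seq_norm X" for X :: "'a padic_seq"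
    by transfer (simp add: rat_padic_abs_minus[OF prime_card])
qed

lemma padic_norm_diff_commute: "padic_norm (x - y) = padic_norm (y - x)"
  using padic_norm_minus[of "x - y"] by simp

lemma padic_norm_add: "padic_norm (x + y) \<le> max (padic_norm x) (padic_norm y)"
proof transfer
  fix X Y :: "'a padic_seq"
  show "padic_seq_norm (X + Y) \<le> max (padic_seq_norm X) (padic_seq_norm Y)"
    by (rule LIMSEQ_le[OF padic_seq_norm_tendsto tendsto_max[OF padic_seq_norm_tendsto padic_seq_norm_tendsto]])
       (auto simp: plus_padic_seq.rep_eq rat_padic_abs_add[OF prime_card])
qed

lemma padic_norm_diff_triangle: "padic_norm (x - z) \<le> padic_norm (x - y) + padic_norm (y - z)"
  using padic_norm_add[of "x - y" "y - z"] padic_norm_nonneg[of "x - y"] padic_norm_nonneg[of "y - z"]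
  by (simp del: padic_norm_nonneg)

instantiation padic :: (prime_card) metric_space
begin

definition dist_padic :: "'a padic \<Rightarrow> 'a padic \<Rightarrow> real" where
  "dist_padic x y = padic_norm (x - y)"
definition uniformity_padic :: "('a padic \<times> 'a padic) filter" where
  "uniformity_padic = (INF e\<in>{0<..}. principal {(x, y). dist x y < e})"
definition open_padic :: "'a padic set \<Rightarrow> bool" where
  "open_padic U \<longleftrightarrow> (\<forall>x\<in>U. eventually (\<lambda>(x', y). x' = x \<longrightarrow> y \<in> U) uniformity)"

instance
proof
  fix x y z :: "'a padic"
  show "dist x y = 0 \<longleftrightarrow> x = y" by (simp add: dist_padic_def)
  show "dist x y \<le> dist x z + dist y z"
    using padic_norm_diff_triangle[of x y z] by (simp add: dist_padic_def padic_norm_diff_commute)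
qed (rule uniformity_padic_def open_padic_def)+

end

lift_definition padic_seq_const :: "rat \<Rightarrow> 'p::prime_card padic_seq" is "\<lambda>q _. q"
  by (rule rat_padic_Cauchy_const[OF prime_card])

lemma padic_seq_const_of_nat: "padic_seq_const (of_nat n) = of_nat n"
proof (induction n)
  case 0
  show ?case by (simp, transfer) simp
next
  case (Suc n)
  have "padic_seq_const (of_nat (Suc n)) = 1 + (padic_seq_const (of_nat n) :: 'a padic_seq)"
    by transfer simp
  thus ?case using Suc by simp
qed

lemma padic_seq_norm_const: "padic_seq_norm (padic_seq_const q :: 'p::prime_card padic_seq) = rat_padic_abs CARD('p) q"
  by transfer simp

lemma abs_padic_of_nat: "abs_padic (of_nat n) = of_nat n"
  by (induction n) (simp_all add: zero_padic.abs_eq one_padic.abs_eq plus_padic.abs_eq[symmetric])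

lemma padic_norm_of_nat: "padic_norm (of_nat n :: 'p::prime_card padic) = rat_padic_abs CARD('p) (of_nat n)"
  unfolding abs_padic_of_nat[symmetric] padic_norm.abs_eq padic_seq_const_of_nat[symmetric] padic_seq_norm_const ..

instance padic :: (prime_card) field_char_0
proof
  show "inj (of_nat :: nat \<Rightarrow> 'a padic)"
  proof (rule linorder_injI)
    fix m n :: nat assume "m < n"
    hence "(of_nat (n - m) :: rat) \<noteq> 0" by simp
    hence "(of_nat (n - m) :: 'a padic) \<noteq> 0"
      unfolding padic_norm_eq_0_iff[symmetric] padic_norm_of_nat
      by (simp only: rat_padic_abs_eq_0_iff[OF prime_card] not_False_eq_True)
    thus "(of_nat m :: 'a padic) \<noteq> of_nat n" using \<open>m < n\<close> by (simp add: of_nat_diff)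
  qed
qed

lemma abs_padic_const: "abs_padic (padic_seq_const q :: 'p::prime_card padic_seq) = of_rat q"
proof -
  let ?c = "\<lambda>q. abs_padic (padic_seq_const q :: 'p padic_seq)"
  have mult: "?c (q * r) = ?c q * ?c r" for q r
    unfolding times_padic.abs_eq by (rule arg_cong[of _ _ abs_padic], transfer) simp
  have minus: "?c (- q) = - ?c q" for q
    unfolding uminus_padic.abs_eq by (rule arg_cong[of _ _ abs_padic], transfer) simp
  have nat: "?c (of_nat n) = of_nat n" for n
    by (simp add: padic_seq_const_of_nat abs_padic_of_nat)
  have int: "?c (of_int k) = of_int k" for k
    using nat minus by (cases k rule: int_cases2) auto
  obtain a b where q: "q = of_int a / of_int b" "b > 0" by (rule rat_frac_cases[OF prime_card[where 'a='p]])
  have "?c q * of_int b = of_int a"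
    unfolding int[symmetric] mult[symmetric] using q by simp
  hence "?c q = of_int a / of_int b" using q(2) by (simp add: eq_divide_eq)
  thus ?thesis by (simp add: q(1) of_rat_divide)
qed

lemma padic_norm_of_rat [simp]:
  "padic_norm (of_rat q :: 'p::prime_card padic) = rat_padic_abs CARD('p) q"
  unfolding abs_padic_const[symmetric] padic_norm.abs_eq padic_seq_norm_const ..

lemma padic_of_rat_LIMSEQ:
  fixes X :: "'p::prime_card padic_seq"
  shows "(\<lambda>n. of_rat (Rep_padic_seq X n)) \<longlonglongrightarrow> abs_padic X"
proof (rule metric_LIMSEQ_I)
  fix e :: real assume "e > 0"
  hence "e / 2 > 0" by simp
  then obtain N where N: "\<And>m n. m \<ge> N \<Longrightarrow> n \<ge> N \<Longrightarrow>
      rat_padic_abs CARD('p) (Rep_padic_seq X m - Rep_padic_seq X n) < e / 2"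
    using Rep_padic_seq[of X] unfolding rat_padic_Cauchy_def mem_Collect_eq by meson
  have "dist (of_rat (Rep_padic_seq X n)) (abs_padic X) < e" if "n \<ge> N" for n
  proof -
    have "dist (of_rat (Rep_padic_seq X n)) (abs_padic X)
            = padic_seq_norm (padic_seq_const (Rep_padic_seq X n) - X)"
      unfolding dist_padic_def abs_padic_const[symmetric] minus_padic_def uminus_padic.abs_eq
        plus_padic.abs_eq padic_norm.abs_eq by simp
    also have "\<dots> \<le> e / 2"
      by (rule LIMSEQ_le_const2[OF padic_seq_norm_tendsto])
         (use N that in \<open>auto simp: minus_padic_seq.rep_eq padic_seq_const.rep_eq intro!: exI[of _ N] less_imp_le\<close>)
    also have "\<dots> < e" using \<open>e > 0\<close> by simp
    finally show ?thesis .
  qed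
  thus "\<exists>N. \<forall>n\<ge>N. dist (of_rat (Rep_padic_seq X n)) (abs_padic X) < e" by blast
qed

lemma padic_rat_dense:
  fixes x :: "'p::prime_card padic"
  assumes "e > 0" shows "\<exists>q. padic_norm (x - of_rat q) < e"
proof -
  obtain X where X: "x = abs_padic X" by (rule that[of "rep_padic x"]) (rule Quotient_abs_rep[OF Quotient_padic, symmetric])
  show ?thesis using metric_LIMSEQ_D[OF padic_of_rat_LIMSEQ[of X] assms]
    unfolding X dist_padic_def by (metis padic_norm_diff_commute order_refl)
qed

instance padic :: (prime_card) complete_space
proof
  fix x :: "nat \<Rightarrow> 'a padic" assume x: "Cauchy x"
  have "\<forall>n. \<exists>q. padic_norm (x n - of_rat q) < inverse (real (Suc n))"
    by (intro allI padic_rat_dense) simp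
  then obtain q where q: "\<And>n. padic_norm (x n - of_rat (q n)) < inverse (real (Suc n))"
    by metis
  have d: "(\<lambda>n. dist (x n) (of_rat (q n))) \<longlonglongrightarrow> 0"
    by (rule tendsto_sandwich[OF _ _ tendsto_const LIMSEQ_inverse_real_of_nat])
       (use q in \<open>auto simp: dist_padic_def intro!: always_eventually less_imp_le\<close>)
  have "rat_padic_Cauchy CARD('a) q" unfolding rat_padic_Cauchy_def
  proof (intro allI impI)
    fix e :: real assume e: "e > 0"
    obtain M where M: "\<And>m n. m \<ge> M \<Longrightarrow> n \<ge> M \<Longrightarrow> dist (x m) (x n) < e"
      using x e unfolding Cauchy_def by meson
    obtain N where N: "\<And>n. n \<ge> N \<Longrightarrow> dist (x n) (of_rat (q n)) < e"
      using order_tendstoD(2)[OF d e] unfolding eventually_sequentially by blast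
    have "rat_padic_abs CARD('a) (q m - q n) < e" if mn: "m \<ge> max M N" "n \<ge> max M N" for m n
    proof -
      have "padic_norm (of_rat (q m) - x m) < e" "padic_norm (x m - x n) < e" "padic_norm (x n - of_rat (q n)) < e"
        using M[of m n] N[of m] N[of n] mn by (auto simp: dist_padic_def padic_norm_diff_commute)
      hence "padic_norm ((of_rat (q m) - x m) + ((x m - x n) + (x n - of_rat (q n)))) < e"
        using padic_norm_add[of "of_rat (q m) - x m" "(x m - x n) + (x n - of_rat (q n))"]
              padic_norm_add[of "x m - x n" "x n - of_rat (q n)"] by linarith
      hence "padic_norm (of_rat (q m - q n) :: 'a padic) < e" by (simp add: of_rat_diff)
      thus ?thesis by simp
    qed
    thus "\<exists>N. \<forall>m\<ge>N. \<forall>n\<ge>N. rat_padic_abs CARD('a) (q m - q n) < e" by blast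
  qed
  hence "Rep_padic_seq (Abs_padic_seq q :: 'a padic_seq) = q" by (simp add: Abs_padic_seq_inverse)
  with padic_of_rat_LIMSEQ[of "Abs_padic_seq q :: 'a padic_seq"]
  have "(\<lambda>n. of_rat (q n)) \<longlonglongrightarrow> (abs_padic (Abs_padic_seq q) :: 'a padic)" by simp
  hence "(\<lambda>n. dist (of_rat (q n)) (abs_padic (Abs_padic_seq q) :: 'a padic)) \<longlonglongrightarrow> 0"
    by (rule tendsto_dist_iff[THEN iffD1])
  from tendsto_add[OF d this, unfolded add_0_left]
  have "(\<lambda>n. dist (x n) (of_rat (q n)) + dist (of_rat (q n)) (abs_padic (Abs_padic_seq q) :: 'a padic)) \<longlonglongrightarrow> 0" .
  hence "(\<lambda>n. dist (x n) (abs_padic (Abs_padic_seq q))) \<longlonglongrightarrow> 0"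
    by (rule tendsto_sandwich[OF _ _ tendsto_const, rotated 2]) (auto intro!: always_eventually dist_triangle)
  hence "x \<longlonglongrightarrow> abs_padic (Abs_padic_seq q)"
    by (rule tendsto_dist_iff[THEN iffD2])
  thus "convergent x" by (rule convergentI)
qed


definition padic_ball :: "int \<Rightarrow> 'p::prime_card padic set" where
  "padic_ball n = {x. padic_norm x \<le> real CARD('p) powi n}"

text \<open>
  Translation invariance and the normalization of the unit ball already force the measure to be
  finite on compact sets, hence to be the normalized Haar measure.
\<close>

definition normalized_haar :: "'p::prime_card padic measure \<Rightarrow> bool" where
  "normalized_haar \<mu> \<longleftrightarrow>
     sets \<mu> = sets borel \<and>
     (\<forall>x. \<forall>A\<in>sets borel. emeasure \<mu> ((+) x ` A) = emeasure \<mu> A) \<and>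
     emeasure \<mu> (padic_ball 0) = 1"

text \<open>
  Functions on the punctured line are total functions on \<open>'p padic\<close> whose value at \<open>0\<close> is never
  inspected, because all integrals and measurability conditions refer to the following measure.
\<close>

definition padic_star :: "'p::prime_card padic measure \<Rightarrow> 'p padic measure" where
  "padic_star \<mu> = restrict_space \<mu> (- {0})"

definition in_Lr :: "'a measure \<Rightarrow> real \<Rightarrow> ('a \<Rightarrow> complex) \<Rightarrow> bool" where
  "in_Lr M r f \<longleftrightarrow> f \<in> borel_measurable M \<and> integrable M (\<lambda>x. cmod (f x) powr r)"

definition Lr_norm :: "'a measure \<Rightarrow> real \<Rightarrow> ('a \<Rightarrow> complex) \<Rightarrow> real" where
  "Lr_norm M r f = (\<integral>x. cmod (f x) powr r \<partial>M) powr (1 / r)"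

definition Lr_loc_star :: "'p::prime_card padic measure \<Rightarrow> real \<Rightarrow> ('p padic \<Rightarrow> complex) set" where
  "Lr_loc_star \<mu> r = {f. f \<in> borel_measurable (padic_star \<mu>) \<and>
     (\<forall>K. compact K \<and> K \<subseteq> - {0} \<longrightarrow> in_Lr (padic_star \<mu>) r (\<lambda>x. indicator K x * f x))}"

text \<open>
  No closure is taken in the support condition, since \<^term>\<open>padic_ball n\<close> is closed.
\<close>

definition central_block ::
  "'p::prime_card padic measure \<Rightarrow> real \<Rightarrow> real \<Rightarrow> ('p padic \<Rightarrow> complex) \<Rightarrow> bool" where
  "central_block \<mu> r \<alpha> a \<longleftrightarrow> in_Lr (padic_star \<mu>) r a \<and>
     (\<exists>n. {x. x \<noteq> 0 \<and> a x \<noteq> 0} \<subseteq> padic_ball n \<and>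
          Lr_norm (padic_star \<mu>) r a \<le> measure \<mu> (padic_ball n) powr (- \<alpha>))"

definition block_decomposition ::
  "'p::prime_card padic measure \<Rightarrow> real \<Rightarrow> real \<Rightarrow> ('p padic \<Rightarrow> complex) \<Rightarrow>
     (nat \<Rightarrow> complex) \<Rightarrow> (nat \<Rightarrow> 'p padic \<Rightarrow> complex) \<Rightarrow> bool" where
  "block_decomposition \<mu> r \<alpha> f c a \<longleftrightarrow>
     summable (\<lambda>k. cmod (c k)) \<and> (\<forall>k. central_block \<mu> r \<alpha> (a k)) \<and>
     (AE x in padic_star \<mu>. (\<lambda>k. c k * a k x) sums f x)"

definition block_space ::
  "'p::prime_card padic measure \<Rightarrow> real \<Rightarrow> real \<Rightarrow> ('p padic \<Rightarrow> complex) set" where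
  "block_space \<mu> r \<alpha> = {f \<in> Lr_loc_star \<mu> r. \<exists>c a. block_decomposition \<mu> r \<alpha> f c a}"

definition block_norm ::
  "'p::prime_card padic measure \<Rightarrow> real \<Rightarrow> real \<Rightarrow> ('p padic \<Rightarrow> complex) \<Rightarrow> real" where
  "block_norm \<mu> r \<alpha> f = Inf {\<Sum>k. cmod (c k) | c. \<exists>a. block_decomposition \<mu> r \<alpha> f c a}"

definition HLP_operator ::
  "'p::prime_card padic measure \<Rightarrow> ('p padic \<Rightarrow> complex) \<Rightarrow> 'p padic \<Rightarrow> complex" where
  "HLP_operator \<mu> f x = (\<integral>y. f y / of_real (max (padic_norm x) (padic_norm y)) \<partial>padic_star \<mu>)"

end

(*
Substituting y = t x gives P f(x) = sum over v of min(1, p^v) times the mean of f(t x) over |t| = p^v.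
If f is a block, this mean is p^(-v (1/r + alpha)) times a block: its support shrinks by the factor
p^v, and by Hoelder's inequality on each sphere its L^r norm is at most p^(-v/r) times that of f.
The weights min(1, p^v) p^(-v (1/r + alpha)) are summable over all integers v precisely because
0 < 1/r + alpha < 1, and their sum is the constant C. For a sum of blocks one obtains a double series
of blocks; it converges at every x because every block satisfies P|a|(x) <= C |x|^(-1/r - alpha).
*)
theory Submission
  imports Defs
begin

section \<open>Balls in the field of p-adic numbers\<close>

text \<open>The substitution is realised by cutting the integral along the shells |y| = p^v |x|,
  where the kernel is constant; each mean becomes a shell integral that depends on x only through
  |x|. The measure enters through |B^n| = p^n, which comes from translation invariance because
  B^(n+1) is a disjoint union of p translates of B^n. The obstacle is that a decomposition of f
  converges only almost everywhere and is not assumed to converge absolutely, while the operator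
  integrates over all of the punctured field. What overcomes it is a bound for the integral of |a|
  over a shell that does not depend on the radius of the ball carrying the block a. It dominates all
  terms of the double series at once, so that Tonelli gives integrability, the exchange of sum and
  integral, and the pointwise bound; the latter also puts the image into L^r on compact sets away
  from 0. The constant is the same for all decompositions of f, which is why it survives the passage
  to the infimum.\<close>

lemma rat_padic_abs_residue:
  assumes p: "prime p" and q: "rat_padic_abs p q \<le> 1"
  shows "\<exists>j<p. rat_padic_abs p (q - of_nat j) < 1"
proof -
  obtain a b where ab: "quotient_of q = (a, b)" by fastforce
  have b: "b > 0" and qab: "q = of_int a / of_int b" and cop: "coprime a b"
    using quotient_of_denom_pos[OF ab] quotient_of_div[OF ab] quotient_of_coprime[OF ab] by auto
  have p1: "real p > 1" using prime_gt_1_nat[OF p] by simp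
  have pi: "prime (int p)" using p by simp
  have nb: "\<not> int p dvd b"
  proof
    assume pb: "int p dvd b"
    with cop pi have na: "\<not> int p dvd a"
      by (metis coprime_common_divisor not_prime_unit)
    hence a0: "a \<noteq> 0" by auto
    have "multiplicity (int p) b > 0"
      using pb b pi by (simp add: prime_multiplicity_gt_zero_iff)
    hence "1 < rat_padic_abs p q"
      unfolding qab using p1 a0 b na
      by (subst rat_padic_abs_frac[OF p]) (auto simp: not_dvd_imp_multiplicity_0 intro: one_less_power)
    with q show False by simp
  qed
  have "coprime b (int p)" using prime_imp_coprime[OF pi nb] by (simp add: coprime_commute)
  then obtain c where c: "[b * c = 1] (mod int p)" using cong_solve_coprime_int by blast
  \<comment> \<open>In lowest terms |q| <= 1 keeps p out of the denominator \<open>b\<close>, so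
    \<open>b\<close> has an inverse \<open>c\<close> modulo p; the digit \<open>j\<close> is the
    residue of \<open>a * c\<close>.\<close>
  define j where "j = nat ((a * c) mod int p)"
  have pp: "int p > 0" using prime_gt_0_nat[OF p] by simp
  have ij: "int j = (a * c) mod int p" using pp by (simp add: j_def)
  have "[int j * b = (a * c) * b] (mod int p)" unfolding ij cong_def by (simp add: mod_mult_left_eq)
  also have "(a * c) * b = a * (b * c)" by simp
  also have "[a * (b * c) = a * 1] (mod int p)" using c by (rule cong_scalar_left)
  finally have "int p dvd a - int j * b" by (simp add: cong_iff_dvd_diff dvd_diff_commute)
  hence d: "a - int j * b = 0 \<or> multiplicity (int p) (a - int j * b) > 0"
    using pi by (metis not_gr_zero not_dvd_imp_multiplicity_0 prime_multiplicity_gt_zero_iff prime_imp_prime_elem)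
  have eq: "q - of_nat j = of_int (a - int j * b) / of_int b" unfolding qab using b by (simp add: field_simps)
  have "rat_padic_abs p (q - of_nat j) < 1"
  proof (cases "a - int j * b = 0")
    case True thus ?thesis unfolding eq by (simp add: rat_padic_abs_0[OF p])
  next
    case False
    hence m: "multiplicity (int p) (a - int j * b) > 0" using d by blast
    have b0: "b \<noteq> 0" using b by simp
    have "real p powi (- int (multiplicity (int p) (a - int j * b))) < 1"
      using m p1 by (simp add: power_int_minus field_simps one_less_power)
    thus ?thesis unfolding eq using nb
      by (subst rat_padic_abs_frac[OF p False b0]) (simp add: not_dvd_imp_multiplicity_0)
  qed
  moreover have "j < p" using ij pp by (metis pos_mod_bound of_nat_less_iff)
  ultimately show ?thesis by blast
qed

section \<open>Values of the norm, and cosets of balls\<close>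

lemma prime_card_gt_1: "1 < real CARD('p::prime_card)"
  using prime_gt_1_nat[OF prime_card[where 'a='p]] by simp

lemma padic_norm_add_eq:
  assumes "padic_norm x < padic_norm y" shows "padic_norm (x + y) = padic_norm y"
proof (rule antisym)
  show "padic_norm (x + y) \<le> padic_norm y" using padic_norm_add[of x y] assms by simp
  show "padic_norm y \<le> padic_norm (x + y)"
    using padic_norm_add[of "x + y" "- x"] assms by (simp add: max_def split: if_splits)
qed

text \<open>A rational q with |x - q| < |x| satisfies |q| = |x| by the ultrametric inequality, so
  the completion has no new norm values.\<close>

lemma padic_norm_power_values:
  fixes x :: "'p::prime_card padic"
  assumes "x \<noteq> 0"
  shows "\<exists>k. padic_norm x = real CARD('p) powi k"
proof -
  have pos: "padic_norm x > 0" using assms by (simp add: less_le)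
  then obtain q where q: "padic_norm (x - of_rat q) < padic_norm x" using padic_rat_dense by blast
  hence "padic_norm (of_rat q - x + x) = padic_norm x"
    by (intro padic_norm_add_eq) (simp add: padic_norm_diff_commute)
  hence "rat_padic_abs CARD('p) q = padic_norm x" by simp
  moreover from this pos have "q \<noteq> 0" by (auto simp: rat_padic_abs_0[OF prime_card])
  ultimately have "padic_norm x = real CARD('p) powi (- rat_padic_val CARD('p) q)"
    by (simp add: rat_padic_abs_def)
  thus ?thesis ..
qed

text \<open>The logarithm is already an integer for nonzero x, and the floor only changes its type.
  An explicit formula, rather than a choice, makes Borel measurability immediate. The value at 0
  carries no meaning.\<close>

definition padic_exponent :: "'p::prime_card padic \<Rightarrow> int" where
  "padic_exponent x = \<lfloor>log (real CARD('p)) (padic_norm x)\<rfloor>"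

lemma padic_norm_eq_powi:
  fixes x :: "'p::prime_card padic"
  assumes "x \<noteq> 0"
  shows "padic_norm x = real CARD('p) powi padic_exponent x"
proof -
  obtain k where k: "padic_norm x = real CARD('p) powi k" using padic_norm_power_values[OF assms] by blast
  have "padic_exponent x = k"
    using prime_card_gt_1[where 'p='p] unfolding padic_exponent_def k
    by (simp add: powr_real_of_int'[symmetric])
  thus ?thesis using k by simp
qed

lemma powi_le_powi_iff: "1 < (b::real) \<Longrightarrow> b powi m \<le> b powi n \<longleftrightarrow> m \<le> n"
  by (metis linorder_not_less order_le_less power_int_strict_increasing)

lemma mem_padic_ball_iff:
  fixes x :: "'p::prime_card padic"
  assumes "x \<noteq> 0" shows "x \<in> padic_ball n \<longleftrightarrow> padic_exponent x \<le> n"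
  using powi_le_powi_iff[OF prime_card_gt_1[where 'p='p]] padic_norm_eq_powi[OF assms]
  by (simp add: padic_ball_def)

lemma padic_norm_inverse: "padic_norm (inverse x) = inverse (padic_norm (x :: 'a::prime_card padic))"
proof (cases "x = 0")
  case False
  hence "padic_norm (inverse x) * padic_norm x = padic_norm (1 :: 'a padic)" by (simp flip: padic_norm_mult)
  also have "padic_norm (1 :: 'a padic) = 1"
    using padic_norm_of_nat[of 1, where 'p='a] by (simp add: rat_padic_abs_1[OF prime_card])
  finally show ?thesis using inverse_unique[of "padic_norm x"] by (metis mult.commute)
qed simp

lemma padic_norm_power: "padic_norm (x ^ n) = padic_norm (x :: 'a::prime_card padic) ^ n"
proof (induction n)
  case 0
  show ?case using padic_norm_of_nat[of 1, where 'p='a] by (simp add: rat_padic_abs_1[OF prime_card])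
qed (simp add: padic_norm_mult)

lemma padic_norm_powi: "padic_norm (x powi n) = padic_norm x powi n"
  by (simp add: power_int_def padic_norm_power padic_norm_inverse)

lemma padic_norm_prime: "padic_norm (of_nat CARD('p) :: 'p::prime_card padic) = inverse (real CARD('p))"
proof -
  let ?p = "CARD('p)"
  have p: "prime ?p" by (rule prime_card)
  have "rat_padic_abs ?p (of_int (int ?p) / of_int 1) = real ?p powi (- 1)"
    using p prime_gt_0_nat[OF p] by (subst rat_padic_abs_frac[OF p]) auto
  thus ?thesis unfolding padic_norm_of_nat by (simp add: power_int_minus)
qed

lemma padic_norm_of_nat_le_1: "padic_norm (of_nat n :: 'p::prime_card padic) \<le> 1"
proof (induction n)
  case (Suc n)
  have "padic_norm (1 :: 'p padic) = 1"
    using padic_norm_of_nat[of 1, where 'p='p] by (simp add: rat_padic_abs_1[OF prime_card])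
  thus ?case using Suc padic_norm_add[of "1 :: 'p padic" "of_nat n"] by simp
qed simp

lemma padic_norm_of_nat_diff:
  assumes "i < CARD('p)" "j < CARD('p)" "i \<noteq> j"
  shows "padic_norm (of_nat i - of_nat j :: 'p::prime_card padic) = 1"
proof -
  have *: "padic_norm (of_nat j - of_nat i :: 'p padic) = 1" if "i < j" "j < CARD('p)" for i j
  proof -
    have p: "prime CARD('p)" by (rule prime_card)
    have "\<not> CARD('p) dvd j - i" using that by (auto dest: dvd_imp_le)
    hence "\<not> int CARD('p) dvd int (j - i)" by (simp only: of_nat_dvd_iff not_False_eq_True)
    hence m: "multiplicity (int CARD('p)) (int (j - i)) = 0" by (rule not_dvd_imp_multiplicity_0)
    have "rat_padic_abs CARD('p) (of_int (int (j - i)) / of_int 1) = 1"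
      using that by (subst rat_padic_abs_frac[OF p]) (auto simp: m simp del: of_nat_diff)
    hence "padic_norm (of_nat (j - i) :: 'p padic) = 1" unfolding padic_norm_of_nat by simp
    thus ?thesis using that by (simp add: of_nat_diff)
  qed
  show ?thesis
  proof (cases "i < j")
    case True
    thus ?thesis using *[of i j] assms by (subst padic_norm_diff_commute)
  qed (use assms *[of j i] in simp)
qed

lemma padic_norm_lt_1_imp:
  fixes x :: "'p::prime_card padic"
  assumes "padic_norm x < 1" shows "padic_norm x \<le> inverse (real CARD('p))"
proof (cases "x = 0")
  case False
  have p: "1 < real CARD('p)" by (rule prime_card_gt_1)
  have "\<not> 0 \<le> padic_exponent x"
    using assms powi_le_powi_iff[OF p, of 0 "padic_exponent x"] padic_norm_eq_powi[OF False] by auto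
  hence "real CARD('p) powi padic_exponent x \<le> real CARD('p) powi (- 1)"
    by (subst powi_le_powi_iff[OF p]) auto
  thus ?thesis using padic_norm_eq_powi[OF False] by (simp add: power_int_minus)
qed simp

text \<open>Density reduces this to residues of rationals. That gives a norm strictly below 1, hence
  at most 1/p because the norm values are discrete.\<close>

lemma padic_residue:
  fixes x :: "'p::prime_card padic"
  assumes "padic_norm x \<le> 1"
  shows "\<exists>j<CARD('p). padic_norm (x - of_nat j) \<le> inverse (real CARD('p))"
proof -
  obtain q where q: "padic_norm (x - of_rat q) < 1" using padic_rat_dense[of 1 x] by auto
  have "padic_norm (of_rat q :: 'p padic) \<le> 1"
    using padic_norm_add[of "of_rat q - x" x] q assms by (simp add: padic_norm_diff_commute)
  hence "rat_padic_abs CARD('p) q \<le> 1" by simp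
  then obtain j where j: "j < CARD('p)" "rat_padic_abs CARD('p) (q - of_nat j) < 1"
    using rat_padic_abs_residue[OF prime_card] by blast
  hence "padic_norm (of_rat (q - of_nat j) :: 'p padic) < 1" by simp
  hence "padic_norm (of_rat q - of_nat j :: 'p padic) < 1" by (simp add: of_rat_diff del: padic_norm_of_rat)
  hence "padic_norm (x - of_nat j) < 1"
    using padic_norm_add[of "x - of_rat q" "of_rat q - of_nat j"] q by simp
  thus ?thesis using padic_norm_lt_1_imp j(1) by blast
qed

text \<open>Since |p| = 1/p, the element \<open>u\<close> has norm p^(n+1), and division by
  \<open>u\<close> turns the claim into the splitting of the unit ball into residue classes modulo
  p. Two different digits differ by an element of norm 1, so their centres are p^(n+1) apart and the
  translates are disjoint.\<close>

lemma padic_ball_Suc: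
  fixes n :: int
  defines "u \<equiv> of_nat CARD('p) powi (- n - 1) :: 'p::prime_card padic"
  shows "padic_ball (n + 1) = (\<Union>j<CARD('p). (+) (of_nat j * u) ` padic_ball n)"
    and "disjoint_family_on (\<lambda>j. (+) (of_nat j * u) ` padic_ball n) {..<CARD('p)}"
proof -
  let ?p = "real CARD('p)"
  have p: "1 < ?p" by (rule prime_card_gt_1)
  have u: "padic_norm u = ?p powi (n + 1)"
    unfolding u_def padic_norm_powi padic_norm_prime
    by (simp flip: power_int_minus add: power_int_inverse add.commute)
  have u0: "u \<noteq> 0" using u p by (metis padic_norm_0 power_int_eq_0_iff not_one_less_zero)
  have step: "?p powi (n + 1) = ?p * ?p powi n" using p by (simp add: power_int_add)
  have mem: "x \<in> (+) (of_nat j * u) ` padic_ball n \<longleftrightarrow> padic_norm (x - of_nat j * u) \<le> ?p powi n" for x j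
    by (auto simp: padic_ball_def image_iff intro!: exI[of _ "x - of_nat j * u"])
  have up: "padic_norm (y * u) \<le> ?p powi n \<longleftrightarrow> padic_norm y \<le> inverse ?p" for y :: "'p padic"
    unfolding padic_norm_mult u step using p by (simp add: field_simps)
  show "padic_ball (n + 1) = (\<Union>j<CARD('p). (+) (of_nat j * u) ` padic_ball n)"
  proof (rule antisym; rule subsetI)
    fix x :: "'p padic" assume "x \<in> padic_ball (n + 1)"
    hence "padic_norm x * inverse (padic_norm u) \<le> 1"
      unfolding u using p by (simp add: padic_ball_def divide_inverse[symmetric] divide_le_eq zero_less_power_int)
    hence "padic_norm (x * inverse u) \<le> 1" by (simp only: padic_norm_mult padic_norm_inverse)
    then obtain j where j: "j < CARD('p)" "padic_norm (x * inverse u - of_nat j) \<le> inverse ?p"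
      using padic_residue by blast
    have "(x * inverse u - of_nat j) * u = x - of_nat j * u" using u0 by (simp add: algebra_simps)
    with up[of "x * inverse u - of_nat j"] j show "x \<in> (\<Union>j<CARD('p). (+) (of_nat j * u) ` padic_ball n)"
      by (auto simp: mem)
  next
    fix x :: "'p padic" assume "x \<in> (\<Union>j<CARD('p). (+) (of_nat j * u) ` padic_ball n)"
    then obtain j where j: "padic_norm (x - of_nat j * u) \<le> ?p powi n" by (auto simp: mem)
    have "padic_norm (of_nat j * u) \<le> ?p powi (n + 1)"
      unfolding padic_norm_mult u using padic_norm_of_nat_le_1[of j, where 'p='p] p
      by (simp add: mult_le_cancel_right1)
    moreover have "?p powi n \<le> ?p powi (n + 1)" using p by (simp add: powi_le_powi_iff)
    ultimately show "x \<in> padic_ball (n + 1)"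
      using padic_norm_add[of "x - of_nat j * u" "of_nat j * u"] j by (simp add: padic_ball_def)
  qed
  show "disjoint_family_on (\<lambda>j. (+) (of_nat j * u) ` padic_ball n) {..<CARD('p)}"
    unfolding disjoint_family_on_def
  proof (intro ballI impI equals0I)
    fix i j x
    assume ij: "i \<in> {..<CARD('p)}" "j \<in> {..<CARD('p)}" "i \<noteq> j"
      and "x \<in> (+) (of_nat i * u) ` padic_ball n \<inter> (+) (of_nat j * u) ` padic_ball n"
    hence x: "padic_norm (x - of_nat i * u) \<le> ?p powi n" "padic_norm (x - of_nat j * u) \<le> ?p powi n"
      by (auto simp: mem)
    have "(x - of_nat j * u) + - (x - of_nat i * u) = (of_nat i - of_nat j) * u" by (simp add: algebra_simps)
    hence "padic_norm ((of_nat i - of_nat j) * u) \<le> ?p powi n"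
      using padic_norm_add[of "x - of_nat j * u" "- (x - of_nat i * u)"] x unfolding padic_norm_minus by simp
    hence "1 \<le> inverse ?p" using padic_norm_of_nat_diff[of i j, where 'p='p] ij unfolding up by simp
    thus False using p by (simp add: field_simps)
  qed
qed

section \<open>Borel structure and the Haar measure of balls\<close>

lemma continuous_on_padic_norm: "continuous_on A (padic_norm :: 'p::prime_card padic \<Rightarrow> real)"
proof -
  have "padic_norm x = dist x 0" for x :: "'p padic" by (simp add: dist_padic_def)
  thus ?thesis by (simp add: continuous_on_dist[OF continuous_on_id continuous_on_const])
qed

lemma borel_measurable_padic_norm [measurable]:
  "(padic_norm :: 'p::prime_card padic \<Rightarrow> real) \<in> borel_measurable borel"
  by (rule borel_measurable_continuous_onI[OF continuous_on_padic_norm])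

lemma measurable_padic_exponent [measurable]:
  "(padic_exponent :: 'p::prime_card padic \<Rightarrow> int) \<in> measurable borel (count_space UNIV)"
  unfolding padic_exponent_def by measurable

lemma sets_padic_ball_translate: "(+) (c :: 'p::prime_card padic) ` padic_ball n \<in> sets borel"
proof -
  have "(+) c ` padic_ball n = {x. dist x c \<le> real CARD('p) powi n}"
    by (auto simp: padic_ball_def image_iff dist_padic_def intro!: exI[of _ "_ - c"])
  also have "\<dots> \<in> sets borel" by (intro borel_closed closed_Collect_le continuous_intros)
  finally show ?thesis .
qed

lemma sets_padic_ball [measurable]: "(padic_ball n :: 'p::prime_card padic set) \<in> sets borel"
  using sets_padic_ball_translate[of 0] by (simp add: image_def)

lemma emeasure_padic_ball_Suc:
  fixes \<mu> :: "'p::prime_card padic measure"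
  assumes "normalized_haar \<mu>"
  shows "emeasure \<mu> (padic_ball (n + 1)) = of_nat CARD('p) * emeasure \<mu> (padic_ball n)"
proof -
  have s: "sets \<mu> = sets borel"
    and t: "\<And>x A. A \<in> sets borel \<Longrightarrow> emeasure \<mu> ((+) x ` A) = emeasure \<mu> A"
    using assms unfolding normalized_haar_def by auto
  show ?thesis unfolding padic_ball_Suc(1)
    by (subst sum_emeasure[OF _ padic_ball_Suc(2), symmetric])
       (auto simp: s sets_padic_ball_translate t)
qed

text \<open>Induction in both directions from the normalized unit ball; the downward step cancels
  the finite nonzero factor p.\<close>

lemma emeasure_padic_ball:
  fixes \<mu> :: "'p::prime_card padic measure"
  assumes "normalized_haar \<mu>"
  shows "emeasure \<mu> (padic_ball n) = ennreal (real CARD('p) powi n)"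
proof (induction n rule: int_induct[where k = 0])
  case base
  show ?case using assms by (simp add: normalized_haar_def)
next
  case (step1 i)
  have "of_nat CARD('p) * ennreal (real CARD('p) powi i) = ennreal (real CARD('p) powi (i + 1))"
    using prime_card_gt_1[where 'p='p]
    by (simp add: power_int_add mult.commute ennreal_mult ennreal_of_nat_eq_real_of_nat)
  thus ?case using step1 emeasure_padic_ball_Suc[OF assms, of i] by simp
next
  case (step2 i)
  have p: "real CARD('p) > 0" using prime_card_gt_1[where 'p='p] by simp
  have "ennreal (real CARD('p)) * emeasure \<mu> (padic_ball (i - 1)) = ennreal (real CARD('p)) * ennreal (real CARD('p) powi (i - 1))"
    using emeasure_padic_ball_Suc[OF assms, of "i - 1"] step2 p
    by (simp add: power_int_diff ennreal_mult[symmetric] ennreal_of_nat_eq_real_of_nat)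
  thus ?case using p by (subst (asm) ennreal_mult_cancel_left) auto
qed

section \<open>Integrals and series\<close>

text \<open>Young's inequality at scale s is the tangent line of the convex function t^r at t = s.
  Integrating it over A and optimizing s gives Hoelder's inequality against the constant 1.\<close>

lemma Holder_indicator:
  fixes f :: "'a \<Rightarrow> 'b::{banach, second_countable_topology}"
  assumes r: "1 < r" and f [measurable]: "f \<in> borel_measurable M"
    and A [measurable]: "A \<in> sets M" and fin: "emeasure M A < \<infinity>"
    and int: "integrable M (\<lambda>x. indicator A x * norm (f x) powr r)"
  shows "integrable M (\<lambda>x. indicator A x * norm (f x))"
    and "(\<integral>x. indicator A x * norm (f x) \<partial>M) powr r
           \<le> measure M A powr (r - 1) * (\<integral>x. indicator A x * norm (f x) powr r \<partial>M)"
proof -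
  have Young: "t \<le> s powr (1 - r) / r * t powr r + s * (1 - 1 / r)" if "s > 0" "t \<ge> 0" for s t :: real
  proof -
    have "t / s * 1 \<le> (t / s) powr r / r + 1 powr (r / (r - 1)) / (r / (r - 1))"
      using r that by (intro Youngs_inequality) (auto simp: field_simps)
    hence "t / s \<le> (t / s) powr r / r + (1 - 1 / r)" using r by (simp add: field_simps)
    hence "t \<le> s * ((t / s) powr r / r + (1 - 1 / r))" using that by (simp add: field_simps)
    also have "\<dots> = s powr (1 - r) / r * t powr r + s * (1 - 1 / r)"
      using that by (simp add: powr_divide powr_diff algebra_simps)
    finally show ?thesis .
  qed
  have ind: "integrable M (indicat_real A)" using fin by (simp add: integrable_indicator_iff)
  define G where "G s x = s powr (1 - r) / r * (indicator A x * norm (f x) powr r) + s * (1 - 1 / r) * indicator A x"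
    for s :: real and x
  have G_int: "integrable M (G s)" for s
    unfolding G_def using int ind by simp
  have le_G: "indicator A x * norm (f x) \<le> G s x" if "s > 0" for s x
    using Young[OF that, of "norm (f x)"] by (auto simp: G_def indicator_def)
  \<comment> \<open>Every fixed scale provides an integrable majorant; the scale 1 is taken
    here.\<close>
  show I: "integrable M (\<lambda>x. indicator A x * norm (f x))"
    by (rule Bochner_Integration.integrable_bound[OF G_int[of 1]]) (use le_G[of 1] in \<open>auto intro: order_trans[OF _ abs_ge_self]\<close>)
  define F where "F = (\<integral>x. indicator A x * norm (f x) \<partial>M)"
  define J where "J = (\<integral>x. indicator A x * norm (f x) powr r \<partial>M)"
  define w where "w = measure M A"
  have F0: "F \<ge> 0" and J0: "J \<ge> 0" unfolding F_def J_def by simp_all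
  have "F powr r \<le> w powr (r - 1) * J"
  proof (cases "F = 0")
    case True
    thus ?thesis using J0 by simp
  next
    case False
    have w: "w > 0"
    proof (rule ccontr)
      assume "\<not> w > 0"
      hence "w = 0" by (simp add: w_def zero_less_measure_iff)
      hence "emeasure M A = 0" using fin by (auto simp: w_def measure_def enn2real_eq_0_iff)
      hence "AE x in M. x \<notin> A" by (intro AE_not_in) (simp add: null_sets_def)
      hence "AE x in M. indicator A x * norm (f x) = 0" by eventually_elim simp
      hence "F = 0" unfolding F_def by (simp add: integral_eq_zero_AE)
      with False show False by simp
    qed
    \<comment> \<open>The optimal scale is the mean of |f| over A: the term linear in
      \<open>s\<close> then integrates to (1 - 1/r) F and is absorbed on the left. It is positive
      because the case F = 0 has been split off.\<close>
    define s where "s = F / w"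
    have s: "s > 0" using False F0 w by (simp add: s_def)
    have "F \<le> (\<integral>x. G s x \<partial>M)"
      unfolding F_def using I G_int le_G[OF s] by (intro integral_mono)
    also have "\<dots> = s powr (1 - r) / r * J + s * (1 - 1 / r) * w"
      unfolding G_def J_def w_def using int ind by simp
    also have "s * (1 - 1 / r) * w = F * (1 - 1 / r)" using w by (simp add: s_def)
    finally have "F \<le> s powr (1 - r) * J" using r by (simp add: field_simps)
    hence "s powr (r - 1) * F \<le> s powr (r - 1) * (s powr (1 - r) * J)" by (intro mult_left_mono) auto
    also have "\<dots> = J" using s by (simp add: mult.assoc[symmetric] powr_add[symmetric])
    finally have "w powr (r - 1) * (s powr (r - 1) * F) \<le> w powr (r - 1) * J" by (intro mult_left_mono) auto
    moreover have "w powr (r - 1) * (s powr (r - 1) * F) = F powr r"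
      using w F0 False by (simp add: s_def powr_divide powr_diff)
    ultimately show ?thesis by simp
  qed
  thus "(\<integral>x. indicator A x * norm (f x) \<partial>M) powr r
           \<le> measure M A powr (r - 1) * (\<integral>x. indicator A x * norm (f x) powr r \<partial>M)"
    by (simp add: F_def J_def w_def)
qed

text \<open>Each point lies in exactly one fiber, and nonnegative sums and integrals commute.
  Writing the sum as an integral over \<open>count_space\<close> admits the integers as index set
  and makes a shift of the index a bijective substitution.\<close>

lemma nn_integral_fibers:
  fixes e :: "'a \<Rightarrow> 'i::countable"
  assumes [measurable]: "g \<in> borel_measurable M" "e \<in> measurable M (count_space UNIV)"
  shows "(\<integral>\<^sup>+x. g x \<partial>M) = (\<integral>\<^sup>+i. (\<integral>\<^sup>+x. indicator {x \<in> space M. e x = i} x * g x \<partial>M) \<partial>count_space UNIV)"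
proof -
  have "(\<integral>\<^sup>+i. indicator {x \<in> space M. e x = i} x * g x \<partial>count_space UNIV) = g x" if "x \<in> space M" for x
  proof -
    have "(\<integral>\<^sup>+i. indicator {x \<in> space M. e x = i} x * g x \<partial>count_space UNIV)
            = (\<Sum>i\<in>{e x}. indicator {x \<in> space M. e x = i} x * g x)"
      by (rule nn_integral_count_space') auto
    thus ?thesis using that by simp
  qed
  hence "(\<integral>\<^sup>+x. g x \<partial>M) = (\<integral>\<^sup>+x. (\<integral>\<^sup>+i. indicator {x \<in> space M. e x = i} x * g x \<partial>count_space UNIV) \<partial>M)"
    by (simp cong: nn_integral_cong_simp)
  also have "\<dots> = (\<integral>\<^sup>+i. (\<integral>\<^sup>+x. indicator {x \<in> space M. e x = i} x * g x \<partial>M) \<partial>count_space UNIV)"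
    by (rule nn_integral_count_space_nn_integral) auto
  finally show ?thesis .
qed

text \<open>Tonelli supplies the almost everywhere absolute convergence required by \<open>sums_integral\<close>.\<close>

lemma sums_integral_Tonelli:
  fixes F :: "nat \<Rightarrow> 'a \<Rightarrow> 'b::{banach, second_countable_topology}"
  assumes int: "\<And>j. integrable M (F j)"
    and le: "\<And>j. (\<integral>x. norm (F j x) \<partial>M) \<le> B j" and B: "summable B"
    and g: "g \<in> borel_measurable M"
    and lim: "AE x in M. summable (\<lambda>j. norm (F j x)) \<longrightarrow> (\<Sum>j. F j x) = g x"
  shows "integrable M g" and "(\<lambda>j. integral\<^sup>L M (F j)) sums integral\<^sup>L M g"
proof -
  have [measurable]: "\<And>j. F j \<in> borel_measurable M" using int by (rule borel_measurable_integrable)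
  have sum: "summable (\<lambda>j. \<integral>x. norm (F j x) \<partial>M)"
    by (rule summable_comparison_test'[OF B, of 0]) (use le in simp)
  have "(\<integral>\<^sup>+x. (\<Sum>j. ennreal (norm (F j x))) \<partial>M) = (\<Sum>j. \<integral>\<^sup>+x. norm (F j x) \<partial>M)"
    by (rule nn_integral_suminf) simp
  also have "\<dots> = (\<Sum>j. ennreal (\<integral>x. norm (F j x) \<partial>M))"
    by (intro arg_cong[where f = suminf] ext nn_integral_eq_integral integrable_norm int) auto
  also have "\<dots> \<noteq> \<infinity>" using sum by (simp add: ennreal_suminf_neq_top)
  finally have "AE x in M. (\<Sum>j. ennreal (norm (F j x))) \<noteq> \<infinity>"
    by (intro nn_integral_PInf_AE) auto
  hence ae: "AE x in M. summable (\<lambda>j. norm (F j x))"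
    by eventually_elim (auto intro: summable_suminf_not_top)
  have eq: "AE x in M. (\<Sum>j. F j x) = g x" using ae lim by eventually_elim simp
  show "integrable M g"
    using integrable_cong_AE[THEN iffD1, OF _ g eq integrable_suminf[OF int ae sum]] by simp
  show "(\<lambda>j. integral\<^sup>L M (F j)) sums integral\<^sup>L M g"
    using sums_integral[OF int ae sum] integral_cong_AE[OF _ g eq] by simp
qed

lemma has_sum_product_mult:
  fixes f :: "'a \<Rightarrow> real" and g :: "'b \<Rightarrow> real"
  assumes f: "(f has_sum s) A" "\<And>x. x \<in> A \<Longrightarrow> f x \<ge> 0"
    and g: "(g has_sum t) B" "\<And>y. y \<in> B \<Longrightarrow> g y \<ge> 0"
  shows "((\<lambda>(x, y). f x * g y) has_sum (s * t)) (A \<times> B)"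
proof -
  have 1: "((\<lambda>y. case (x, y) of (x, y) \<Rightarrow> f x * g y) has_sum (f x * t)) B" for x
    using has_sum_cmult_right[OF g(1), of "f x"] by simp
  have 2: "((\<lambda>x. f x * t) has_sum (s * t)) A"
    by (rule has_sum_cmult_left[OF f(1)])
  have 3: "(\<lambda>x. f x * t) summable_on A" using 2 by (rule has_sum_imp_summable)
  have "(\<lambda>(x, y). f x * g y) summable_on A \<times> B"
    by (rule summable_on_SigmaI[OF 1 3]) (simp add: f(2) g(2))
  thus ?thesis by (rule has_sum_SigmaI[OF 1 2])
qed

text \<open>Two geometric series; the negative integers are listed as -(n + 1) so that 0 is counted
  once.\<close>

lemma summable_on_power_nat_abs:
  fixes q :: real
  assumes "0 \<le> q" "q < 1"
  shows "(\<lambda>v::int. q ^ nat \<bar>v\<bar>) summable_on UNIV"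
proof -
  have geo: "(\<lambda>n. q ^ n) summable_on UNIV" "(\<lambda>n. q ^ Suc n) summable_on UNIV"
    using assms summable_geometric[of q] summable_mult[of "\<lambda>n. q ^ n" q]
    by (auto simp: summable_on_UNIV_nonneg_real_iff)
  have "(\<lambda>v::int. q ^ nat \<bar>v\<bar>) summable_on (range int)"
    by (subst summable_on_reindex) (use geo in \<open>auto simp: o_def\<close>)
  moreover have "(\<lambda>v::int. q ^ nat \<bar>v\<bar>) summable_on (range (\<lambda>n. - int (Suc n)))"
    by (subst summable_on_reindex) (use geo in \<open>auto simp: o_def inj_def nat_add_distrib\<close>)
  moreover have "range int \<inter> range (\<lambda>n. - int (Suc n)) = {}" by auto
  ultimately have "(\<lambda>v::int. q ^ nat \<bar>v\<bar>) summable_on (range int \<union> range (\<lambda>n. - int (Suc n)))"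
    by (rule summable_on_Un_disjoint)
  also have "range int \<union> range (\<lambda>n. - int (Suc n)) = UNIV"
  proof (rule UNIV_eq_I[symmetric])
    show "v \<in> range int \<union> range (\<lambda>n. - int (Suc n))" for v
      by (cases v) (blast, blast)
  qed
  finally show ?thesis .
qed

section \<open>The operator on blocks\<close>

text \<open>The prime is carried as a real number so that it can be raised to real exponents by
  \<open>powr\<close>.\<close>

locale haar_padic =
  fixes \<mu> :: "'p::prime_card padic measure" and p :: real
  assumes haar: "normalized_haar \<mu>" and p_def: "p = real CARD('p)"
begin

abbreviation "M \<equiv> padic_star \<mu>"

lemma p_gt_1: "1 < p"
  unfolding p_def by (rule prime_card_gt_1)

lemma padic_norm_eq_powr: "x \<noteq> 0 \<Longrightarrow> padic_norm (x :: 'p padic) = p powr padic_exponent x"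
  using p_gt_1 by (simp add: padic_norm_eq_powi powr_real_of_int' p_def)

lemma measure_padic_ball: "measure \<mu> (padic_ball n) = p powr real_of_int n"
  using emeasure_padic_ball[OF haar, of n] p_gt_1 by (simp add: measure_def powr_real_of_int' p_def)

lemma space_M [simp]: "space M = - {0}" and measurable_M: "f \<in> measurable borel N \<Longrightarrow> f \<in> measurable M N"
proof -
  have s: "sets \<mu> = sets borel" using haar by (simp add: normalized_haar_def)
  thus "space M = - {0}" using sets_eq_imp_space_eq[OF s] by (simp add: padic_star_def space_restrict_space)
  show "f \<in> measurable M N" if "f \<in> measurable borel N"
    unfolding padic_star_def using that measurable_cong_sets[OF s refl, of N]
    by (intro measurable_restrict_space1) simp
qed

lemma measurable_M_exponent [measurable]: "padic_exponent \<in> measurable M (count_space UNIV)"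
  by (rule measurable_M) measurable

lemma measurable_M_norm [measurable]: "padic_norm \<in> borel_measurable M"
  by (rule measurable_M) measurable

lemma emeasure_M: "A \<subseteq> - {0} \<Longrightarrow> emeasure M A = emeasure \<mu> A"
  unfolding padic_star_def using haar
  by (intro emeasure_restrict_space) (auto simp: normalized_haar_def sets_eq_imp_space_eq[of \<mu> borel])

lemma emeasure_M_le_ball:
  assumes "A \<subseteq> padic_ball n - {0}" shows "emeasure M A \<le> ennreal (p powr real_of_int n)"
proof -
  have "emeasure M A \<le> emeasure \<mu> (padic_ball n)"
    using assms haar by (subst emeasure_M) (auto intro!: emeasure_mono simp: normalized_haar_def)
  thus ?thesis using emeasure_padic_ball[OF haar, of n] p_gt_1 by (simp add: powr_real_of_int' p_def)
qed

definition shell :: "int \<Rightarrow> 'p padic set" where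
  "shell m = {x \<in> space M. padic_exponent x = m}"

lemma sets_shell [measurable]: "shell m \<in> sets M"
  unfolding shell_def by measurable

text \<open>Comparison with the enclosing ball loses only the factor 1 - 1/p.\<close>

lemma emeasure_shell_le: "emeasure M (shell m) \<le> ennreal (p powr real_of_int m)"
  by (rule emeasure_M_le_ball) (auto simp: shell_def mem_padic_ball_iff)

lemma measure_shell_le: "measure M (shell m) \<le> p powr real_of_int m"
  using emeasure_shell_le[of m] unfolding measure_def by (intro enn2real_leI) auto

lemma emeasure_shell_finite: "emeasure M (shell m) < \<infinity>"
  using emeasure_shell_le[of m] by (auto intro: le_less_trans)

definition shell_integral :: "int \<Rightarrow> ('p padic \<Rightarrow> complex) \<Rightarrow> complex" where
  "shell_integral m a = (\<integral>x. of_real (indicator (shell m) x) * a x \<partial>M)"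

end

section \<open>Blocks on shells and their dilations\<close>

locale block_exponents = haar_padic \<mu> p
  for \<mu> :: "'p::prime_card padic measure" and p +
  fixes r \<alpha> :: real
  assumes r: "1 < r" and \<alpha>: "0 < \<alpha>" and r\<alpha>: "1 / r + \<alpha> < 1"
begin

definition \<beta> :: real where "\<beta> = 1 / r + \<alpha>"

lemma \<beta>_bounds: "0 < \<beta>" "\<beta> < 1"
  using r \<alpha> r\<alpha> by (auto simp: \<beta>_def add_pos_pos)

lemma r_\<beta>: "r * \<beta> = 1 + r * \<alpha>"
  using r by (simp add: \<beta>_def distrib_left)

lemma shell_Lr_integrable:
  assumes "in_Lr M r a"
  shows "integrable M (\<lambda>x. indicator (shell m) x * cmod (a x) powr r)"
  using integrable_mult_indicator[OF sets_shell[of m], of "\<lambda>x. cmod (a x) powr r"] assms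
  by (simp add: in_Lr_def)

lemma shell_Holder:
  assumes a: "in_Lr M r a"
  shows "integrable M (\<lambda>x. indicator (shell m) x * cmod (a x))"
    and "(\<integral>x. indicator (shell m) x * cmod (a x) \<partial>M) powr r
           \<le> p powr (real_of_int m * (r - 1)) * (\<integral>x. indicator (shell m) x * cmod (a x) powr r \<partial>M)"
proof -
  have [measurable]: "a \<in> borel_measurable M" using a by (simp add: in_Lr_def)
  note H = Holder_indicator[OF r _ sets_shell emeasure_shell_finite shell_Lr_integrable[OF a], of m]
  show "integrable M (\<lambda>x. indicator (shell m) x * cmod (a x))" by (rule H(1)) simp
  have "(\<integral>x. indicator (shell m) x * cmod (a x) \<partial>M) powr r
          \<le> measure M (shell m) powr (r - 1) * (\<integral>x. indicator (shell m) x * cmod (a x) powr r \<partial>M)"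
    by (rule H(2)) simp
  also have "\<dots> \<le> (p powr real_of_int m) powr (r - 1) * (\<integral>x. indicator (shell m) x * cmod (a x) powr r \<partial>M)"
    using measure_shell_le[of m] r by (intro mult_right_mono powr_mono2) auto
  finally show "(\<integral>x. indicator (shell m) x * cmod (a x) \<partial>M) powr r
           \<le> p powr (real_of_int m * (r - 1)) * (\<integral>x. indicator (shell m) x * cmod (a x) powr r \<partial>M)"
    by (simp add: powr_powr)
qed

lemma norm_shell_integral_le:
  "cmod (shell_integral m a) \<le> (\<integral>x. indicator (shell m) x * cmod (a x) \<partial>M)"
  unfolding shell_integral_def
  by (rule order_trans[OF integral_norm_bound]) (simp add: norm_mult)

lemma in_Lr_integral_powr: "(\<integral>x. cmod (a x) powr r \<partial>M) = Lr_norm M r a powr r"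
  using r by (simp add: Lr_norm_def powr_powr)

text \<open>The radius p^n of the block drops out: shells with m > n contribute nothing, and for m
  <= n Hoelder's inequality gives the factor p^(m (1 - 1/r)) while the norm bound p^(-n \<alpha>) is
  at most p^(-m \<alpha>).\<close>

lemma block_shell_bound:
  assumes a: "central_block \<mu> r \<alpha> a"
  shows "(\<integral>x. indicator (shell m) x * cmod (a x) \<partial>M) \<le> p powr (real_of_int m * (1 - \<beta>))"
proof -
  obtain n where L: "in_Lr M r a" and supp: "{x. x \<noteq> 0 \<and> a x \<noteq> 0} \<subseteq> padic_ball n"
    and norm: "Lr_norm M r a \<le> (p powr real_of_int n) powr (- \<alpha>)"
    using a unfolding central_block_def measure_padic_ball by blast
  show ?thesis
  proof (cases "m \<le> n")
    case False
    have "indicator (shell m) x * cmod (a x) = 0" for x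
      using supp False by (auto simp: shell_def indicator_def mem_padic_ball_iff subset_iff)
    hence "(\<integral>x. indicator (shell m) x * cmod (a x) \<partial>M) = 0" by (simp only: integral_zero)
    thus ?thesis by simp
  next
    case True
    define F where "F = (\<integral>x. indicator (shell m) x * cmod (a x) \<partial>M)"
    have F0: "F \<ge> 0" unfolding F_def by simp
    have "(\<integral>x. indicator (shell m) x * cmod (a x) powr r \<partial>M) \<le> (\<integral>x. cmod (a x) powr r \<partial>M)"
      using shell_Lr_integrable[OF L] L
      by (intro integral_mono) (auto simp: in_Lr_def indicator_def)
    also have "\<dots> \<le> ((p powr real_of_int n) powr (- \<alpha>)) powr r"
      unfolding in_Lr_integral_powr using norm r by (intro powr_mono2) (auto simp: Lr_norm_def)
    also have "\<dots> \<le> p powr (- real_of_int m * \<alpha> * r)"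
      unfolding powr_powr using True p_gt_1 \<alpha> r by (intro powr_mono) auto
    finally have "F powr r \<le> p powr (real_of_int m * (r - 1)) * p powr (- real_of_int m * \<alpha> * r)"
      using shell_Holder(2)[OF L, of m] unfolding F_def
      by (meson mult_left_mono order_trans powr_ge_zero)
    also have "\<dots> = (p powr (real_of_int m * (1 - \<beta>))) powr r"
      using arg_cong[OF r_\<beta>, of "\<lambda>t. real_of_int m * t"]
      by (simp add: powr_powr powr_add[symmetric] algebra_simps)
    finally show ?thesis using r F0 unfolding F_def[symmetric]
      by (meson less_trans not_le powr_ge_zero powr_less_mono2 zero_less_one)
  qed
qed

text \<open>
  Up to the factor \<open>p powr (v * \<beta>)\<close>, the value at \<open>x\<close> is the integral of \<open>a (t * x)\<close> over
  \<open>\<bar>t\<bar> = p ^ v\<close>, divided by \<open>p ^ v\<close>; the factor makes the dilation of a block a block.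
\<close>

definition dilation_mean :: "int \<Rightarrow> ('p padic \<Rightarrow> complex) \<Rightarrow> 'p padic \<Rightarrow> complex" where
  "dilation_mean v a x =
     of_real (p powr (real_of_int v * \<beta> - real_of_int v - real_of_int (padic_exponent x))) * shell_integral (padic_exponent x + v) a"

text \<open>The function factors through the exponent, which takes values in a discrete space where
  every function is measurable.\<close>

lemma measurable_dilation_mean [measurable]: "dilation_mean v a \<in> borel_measurable M"
proof -
  have "dilation_mean v a = (\<lambda>m. of_real (p powr (real_of_int v * \<beta> - real_of_int v - real_of_int m)) * shell_integral (m + v) a) \<circ> padic_exponent"
    by (simp add: dilation_mean_def fun_eq_iff)
  also have "\<dots> \<in> borel_measurable M" by (rule measurable_comp[OF measurable_M_exponent]) simp
  finally show ?thesis .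
qed

text \<open>The dilation is constant on each shell, so its integral over shell m is controlled by
  Hoelder's inequality on shell m + v; summing over m recovers the whole integral of |a|^r. The
  nonnegative integral is used because integrability of the dilation is a consequence of this
  bound.\<close>

lemma nn_integral_dilation_mean:
  assumes L: "in_Lr M r a"
  shows "(\<integral>\<^sup>+x. ennreal (cmod (dilation_mean v a x) powr r) \<partial>M)
           \<le> ennreal (p powr (r * real_of_int v * \<alpha>) * (\<integral>x. cmod (a x) powr r \<partial>M))"
proof -
  have [measurable]: "a \<in> borel_measurable M" using L by (simp add: in_Lr_def)
  define J where "J m = (\<integral>x. indicator (shell m) x * cmod (a x) powr r \<partial>M)" for m
  have J0: "J m \<ge> 0" for m unfolding J_def by simp
  have J_nn: "(\<integral>\<^sup>+x. indicator (shell m) x * ennreal (cmod (a x) powr r) \<partial>M) = ennreal (J m)" for m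
  proof -
    have "(\<integral>\<^sup>+x. indicator (shell m) x * ennreal (cmod (a x) powr r) \<partial>M)
            = (\<integral>\<^sup>+x. ennreal (indicator (shell m) x * cmod (a x) powr r) \<partial>M)"
      by (intro nn_integral_cong) (simp add: indicator_def)
    also have "\<dots> = ennreal (J m)"
      unfolding J_def by (rule nn_integral_eq_integral[OF shell_Lr_integrable[OF L]]) simp
    finally show ?thesis .
  qed
  have sph: "(\<integral>\<^sup>+x. indicator (shell m) x * ennreal (cmod (dilation_mean v a x) powr r) \<partial>M)
      \<le> ennreal (p powr (r * real_of_int v * \<alpha>)) * ennreal (J (m + v))" for m
  proof -
    \<comment> \<open>The constant modulus of the dilation on shell \<open>m\<close>.\<close>
    define h where "h = cmod (of_real (p powr (real_of_int v * \<beta> - real_of_int v - real_of_int m)) * shell_integral (m + v) a)"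
    have le: "h powr r * p powr real_of_int m \<le> p powr (r * real_of_int v * \<alpha>) * J (m + v)"
    proof -
      have "h powr r = p powr (r * (real_of_int v * \<beta> - real_of_int v - real_of_int m)) * cmod (shell_integral (m + v) a) powr r"
        by (simp add: h_def norm_mult powr_mult powr_powr mult.commute)
      also have "cmod (shell_integral (m + v) a) powr r
          \<le> (\<integral>x. indicator (shell (m + v)) x * cmod (a x) \<partial>M) powr r"
        using norm_shell_integral_le r by (intro powr_mono2) auto
      also have "\<dots> \<le> p powr ((real_of_int m + real_of_int v) * (r - 1)) * J (m + v)"
        unfolding J_def using shell_Holder(2)[OF L, of "m + v"] by simp
      finally have "h powr r * p powr real_of_int m
          \<le> p powr (r * (real_of_int v * \<beta> - real_of_int v - real_of_int m)) * (p powr ((real_of_int m + real_of_int v) * (r - 1)) * J (m + v)) * p powr real_of_int m"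
        by (simp add: mult_left_mono mult_right_mono)
      also have "\<dots> = p powr (r * (real_of_int v * \<beta> - real_of_int v - real_of_int m) + (real_of_int m + real_of_int v) * (r - 1) + real_of_int m) * J (m + v)"
        by (simp add: powr_add)
      \<comment> \<open>All powers involving m cancel, which makes the bound uniform over the
        shells.\<close>
      also have "r * (real_of_int v * \<beta> - real_of_int v - real_of_int m) + (real_of_int m + real_of_int v) * (r - 1) + real_of_int m = real_of_int v * (r * \<beta>) - real_of_int v"
        by (simp add: algebra_simps)
      also have "\<dots> = r * real_of_int v * \<alpha>" unfolding r_\<beta> by (simp add: algebra_simps)
      finally show ?thesis .
    qed
    have "(\<integral>\<^sup>+x. indicator (shell m) x * ennreal (cmod (dilation_mean v a x) powr r) \<partial>M)
           = (\<integral>\<^sup>+x. ennreal (h powr r) * indicator (shell m) x \<partial>M)"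
      by (intro nn_integral_cong) (auto simp: indicator_def shell_def dilation_mean_def h_def)
    also have "\<dots> = ennreal (h powr r) * emeasure M (shell m)"
      by (rule nn_integral_cmult_indicator) simp
    also have "\<dots> \<le> ennreal (h powr r) * ennreal (p powr real_of_int m)"
      by (intro mult_left_mono emeasure_shell_le) simp
    also have "\<dots> = ennreal (h powr r * p powr real_of_int m)" by (simp add: ennreal_mult)
    also have "\<dots> \<le> ennreal (p powr (r * real_of_int v * \<alpha>) * J (m + v))" by (rule ennreal_leI[OF le])
    finally show ?thesis by (simp add: ennreal_mult J0)
  qed
  have shift: "bij (\<lambda>m::int. m + v)" by (rule bij_betwI[of _ _ _ "\<lambda>m. m - v"]) auto
  have "(\<integral>\<^sup>+x. ennreal (cmod (dilation_mean v a x) powr r) \<partial>M)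
      = (\<integral>\<^sup>+m. (\<integral>\<^sup>+x. indicator (shell m) x * ennreal (cmod (dilation_mean v a x) powr r) \<partial>M) \<partial>count_space UNIV)"
    unfolding shell_def by (rule nn_integral_fibers) auto
  also have "\<dots> \<le> (\<integral>\<^sup>+m. ennreal (p powr (r * real_of_int v * \<alpha>)) * ennreal (J (m + v)) \<partial>count_space UNIV)"
    by (intro nn_integral_mono sph)
  also have "\<dots> = ennreal (p powr (r * real_of_int v * \<alpha>)) * (\<integral>\<^sup>+m. ennreal (J (m + v)) \<partial>count_space UNIV)"
    by (rule nn_integral_cmult) simp
  also have "(\<integral>\<^sup>+m. ennreal (J (m + v)) \<partial>count_space UNIV) = (\<integral>\<^sup>+m. ennreal (J m) \<partial>count_space UNIV)"
    by (rule nn_integral_bij_count_space[OF shift])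
  also have "\<dots> = (\<integral>\<^sup>+x. ennreal (cmod (a x) powr r) \<partial>M)"
    unfolding J_nn[symmetric] shell_def by (rule nn_integral_fibers[symmetric]) auto
  also have "\<dots> = ennreal (\<integral>x. cmod (a x) powr r \<partial>M)"
    using L by (intro nn_integral_eq_integral) (auto simp: in_Lr_def)
  finally show ?thesis by (simp add: ennreal_mult)
qed

text \<open>The norm grows by at most p^(v \<alpha>), which is exactly the ratio of the norms
  allowed on the balls of exponents n - v and n. Hence the dilation is a block with no further
  constant.\<close>

lemma central_block_dilation_mean:
  assumes a: "central_block \<mu> r \<alpha> a"
  shows "central_block \<mu> r \<alpha> (dilation_mean v a)"
proof -
  obtain n where L: "in_Lr M r a" and supp: "{x. x \<noteq> 0 \<and> a x \<noteq> 0} \<subseteq> padic_ball n"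
    and norm: "Lr_norm M r a \<le> (p powr real_of_int n) powr (- \<alpha>)"
    using a unfolding central_block_def measure_padic_ball by blast
  note nn = nn_integral_dilation_mean[OF L, of v]
  have int: "integrable M (\<lambda>x. cmod (dilation_mean v a x) powr r)"
    by (rule integrableI_bounded) (use nn in \<open>auto intro: le_less_trans\<close>)
  have "(\<integral>x. cmod (dilation_mean v a x) powr r \<partial>M) \<le> p powr (r * real_of_int v * \<alpha>) * (\<integral>x. cmod (a x) powr r \<partial>M)"
    using nn nn_integral_eq_integral[OF int] by (simp add: ennreal_le_iff)
  hence "Lr_norm M r (dilation_mean v a) \<le> (p powr (r * real_of_int v * \<alpha>) * (\<integral>x. cmod (a x) powr r \<partial>M)) powr (1 / r)"
    unfolding Lr_norm_def using r by (intro powr_mono2) auto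
  also have "\<dots> = p powr (real_of_int v * \<alpha>) * Lr_norm M r a"
    using r by (simp add: powr_mult powr_powr Lr_norm_def)
  also have "\<dots> \<le> p powr (real_of_int v * \<alpha>) * (p powr real_of_int n) powr (- \<alpha>)" using norm by (intro mult_left_mono) auto
  also have "\<dots> = (p powr real_of_int (n - v)) powr (- \<alpha>)" by (simp add: powr_powr powr_add[symmetric] algebra_simps)
  finally have "Lr_norm M r (dilation_mean v a) \<le> measure \<mu> (padic_ball (n - v)) powr (- \<alpha>)"
    by (simp add: measure_padic_ball)
  moreover have "{x. x \<noteq> 0 \<and> dilation_mean v a x \<noteq> 0} \<subseteq> padic_ball (n - v)"
  proof
    fix x assume "x \<in> {x. x \<noteq> 0 \<and> dilation_mean v a x \<noteq> 0}"
    hence x: "x \<noteq> 0" "shell_integral (padic_exponent x + v) a \<noteq> 0" by (auto simp: dilation_mean_def)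
    then obtain y where "y \<in> shell (padic_exponent x + v)" "a y \<noteq> 0"
      unfolding shell_integral_def by (metis (no_types, lifting) indicator_simps(2) integral_zero
        mult_eq_0_iff of_real_0 Bochner_Integration.integral_cong)
    hence "padic_exponent x + v \<le> n" using supp by (auto simp: shell_def subset_iff mem_padic_ball_iff)
    thus "x \<in> padic_ball (n - v)" using x by (simp add: mem_padic_ball_iff)
  qed
  ultimately show ?thesis using int unfolding central_block_def in_Lr_def by auto
qed

end

section \<open>The kernel and the weights\<close>

context block_exponents
begin

definition weight :: "int \<Rightarrow> real" where
  "weight v = min 1 (p powr v) * p powr (- real_of_int v * \<beta>)"

lemma weight_nonneg [simp]: "weight v \<ge> 0"
  by (simp add: weight_def)

lemma weight_summable: "weight summable_on UNIV"
proof -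
  \<comment> \<open>For v >= 0 the weight is p^(-v \<beta>), for v < 0 it is p^(v (1 - \<beta>));
    the smaller rate \<gamma> serves both directions.\<close>
  define \<gamma> where "\<gamma> = min \<beta> (1 - \<beta>)"
  define q where "q = p powr (- \<gamma>)"
  have \<gamma>: "\<gamma> > 0" using \<beta>_bounds by (simp add: \<gamma>_def)
  have q: "0 \<le> q" "q < 1" using p_gt_1 \<gamma> by (auto simp: q_def powr_less_one)
  have pow: "q powr real n = q ^ n" for n
    using p_gt_1 by (intro powr_realpow) (simp add: q_def)
  have le: "weight v \<le> q ^ nat \<bar>v\<bar>" for v
  proof (cases "v \<ge> 0")
    case True
    have "weight v = p powr (- real_of_int v * \<beta>)"
      using True p_gt_1 ge_one_powr_ge_zero[of p "real_of_int v"] by (simp add: weight_def)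
    also have "\<dots> \<le> p powr (- \<gamma> * real_of_int v)"
      using True p_gt_1 by (intro powr_mono) (auto simp: \<gamma>_def mult.commute intro!: mult_left_mono)
    also have "\<dots> = q powr real (nat \<bar>v\<bar>)" using True by (simp add: q_def powr_powr)
    finally show ?thesis unfolding pow .
  next
    case False
    hence "p powr real_of_int v \<le> 1"
      using p_gt_1 powr_mono[of "real_of_int v" 0 p] by simp
    hence "weight v = p powr (real_of_int v * (1 - \<beta>))"
      by (simp add: weight_def powr_add[symmetric] algebra_simps)
    also have "\<dots> \<le> p powr (\<gamma> * real_of_int v)"
      using False p_gt_1
      by (intro powr_mono) (auto simp: \<gamma>_def mult.commute intro!: mult_right_mono_neg)
    also have "\<dots> = q powr real (nat \<bar>v\<bar>)" using False by (simp add: q_def powr_powr)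
    finally show ?thesis unfolding pow .
  qed
  show ?thesis
    by (rule summable_on_comparison_test[OF summable_on_power_nat_abs[OF q]]) (use le in auto)
qed

text \<open>This is 1 / max(|x|, |y|) for |y| = p^v |x|.\<close>

definition kernel :: "int \<Rightarrow> 'p padic \<Rightarrow> real" where
  "kernel v x = p powr (- real_of_int (padic_exponent x) - real_of_int v) * min 1 (p powr v)"

lemma kernel_nonneg [simp]: "kernel v x \<ge> 0"
  by (simp add: kernel_def)

lemma inverse_max_eq_kernel:
  fixes x y :: "'p padic"
  assumes "x \<noteq> 0" "y \<noteq> 0"
  shows "inverse (max (padic_norm x) (padic_norm y)) = kernel (padic_exponent y - padic_exponent x) x"
proof (cases "padic_exponent x \<le> padic_exponent y")
  case True
  hence "p powr padic_exponent x \<le> p powr padic_exponent y"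
    and "1 \<le> p powr real_of_int (padic_exponent y - padic_exponent x)"
    using p_gt_1 by (auto intro: ge_one_powr_ge_zero)
  hence "max (padic_norm x) (padic_norm y) = p powr padic_exponent y"
    and "kernel (padic_exponent y - padic_exponent x) x = p powr (- real_of_int (padic_exponent y))"
    using assms by (auto simp: padic_norm_eq_powr kernel_def)
  thus ?thesis by (simp only: powr_minus)
next
  case False
  hence "p powr padic_exponent y \<le> p powr padic_exponent x"
    and "p powr real_of_int (padic_exponent y - padic_exponent x) \<le> 1"
    using p_gt_1 powr_mono[of "real_of_int (padic_exponent y - padic_exponent x)" 0 p] by auto
  hence "max (padic_norm x) (padic_norm y) = p powr padic_exponent x"
    and "kernel (padic_exponent y - padic_exponent x) x = p powr (- real_of_int (padic_exponent x))"
    using assms by (auto simp: padic_norm_eq_powr kernel_def min_def simp flip: powr_add)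
  thus ?thesis by (simp only: powr_minus)
qed

lemma shell_integrable:
  assumes "in_Lr M r a"
  shows "integrable M (\<lambda>x. of_real (indicator (shell m) x) * a x)"
proof (rule Bochner_Integration.integrable_bound[OF shell_Holder(1)[OF assms, of m]])
  have [measurable]: "a \<in> borel_measurable M" using assms by (simp add: in_Lr_def)
  show "(\<lambda>x. of_real (indicator (shell m) x) * a x) \<in> borel_measurable M" by measurable
qed (simp add: norm_mult)

text \<open>The contribution of one shell to the operator is thus a scalar times a block: the factor
  p^(-v \<beta>) of the weight offsets the p^(v \<beta>) built into the dilation.\<close>

lemma kernel_shell_integral:
  "of_real (kernel v x) * shell_integral (padic_exponent x + v) a = of_real (weight v) * dilation_mean v a x"
proof -
  have "p powr (- real_of_int (padic_exponent x) - real_of_int v)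
      = p powr (- real_of_int v * \<beta>) * p powr (real_of_int v * \<beta> - real_of_int v - real_of_int (padic_exponent x))"
    unfolding powr_add[symmetric] by (rule arg_cong[of _ _ "\<lambda>t. p powr t"]) simp
  hence "kernel v x = weight v * p powr (real_of_int v * \<beta> - real_of_int v - real_of_int (padic_exponent x))"
    by (simp add: kernel_def weight_def)
  thus ?thesis by (simp add: dilation_mean_def mult.assoc)
qed

text \<open>The dependence on x separates as |x|^(-\<beta>), leaving a summable factor in v.\<close>

lemma kernel_shell_bound:
  "kernel v x * p powr (real_of_int (padic_exponent x + v) * (1 - \<beta>))
     = weight v * p powr (- real_of_int (padic_exponent x) * \<beta>)"
  by (simp add: kernel_def weight_def powr_add[symmetric] algebra_simps)

end

section \<open>The double series attached to a decomposition\<close>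

locale block_sum = block_exponents \<mu> p r \<alpha>
  for \<mu> :: "'p::prime_card padic measure" and p r \<alpha> +
  fixes f :: "'p padic \<Rightarrow> complex" and c :: "nat \<Rightarrow> complex" and a :: "nat \<Rightarrow> 'p padic \<Rightarrow> complex"
  assumes f [measurable]: "f \<in> borel_measurable M" and dec: "block_decomposition \<mu> r \<alpha> f c a"
begin

text \<open>Decompositions are indexed by natural numbers, whereas the terms here are indexed by
  pairs of a block and a shell shift.\<close>

definition enum :: "nat \<Rightarrow> nat \<times> int" where
  "enum = from_nat_into UNIV"

lemma bij_enum: "bij enum"
  unfolding enum_def using bij_betw_from_nat_into[of "UNIV :: (nat \<times> int) set"]
  by (simp add: finite_prod)

definition mean_coeff :: "nat \<Rightarrow> complex" where
  "mean_coeff j = (case enum j of (k, v) \<Rightarrow> c k * of_real (weight v))"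

definition mean_block :: "nat \<Rightarrow> 'p padic \<Rightarrow> complex" where
  "mean_block j = (case enum j of (k, v) \<Rightarrow> dilation_mean v (a k))"

lemma blocks: "central_block \<mu> r \<alpha> (a k)" "in_Lr M r (a k)"
  using dec by (auto simp: block_decomposition_def central_block_def)

text \<open>Both families are nonnegative, so the sum over pairs factors and does not depend on the
  enumeration. The second factor is the constant of the theorem.\<close>

lemma mean_coeff_sums: "(\<lambda>j. cmod (mean_coeff j)) sums ((\<Sum>k. cmod (c k)) * infsum weight UNIV)"
proof -
  have "summable (\<lambda>k. cmod (c k))" using dec by (simp add: block_decomposition_def)
  hence "((\<lambda>k. cmod (c k)) has_sum (\<Sum>k. cmod (c k))) UNIV"
    by (intro norm_summable_imp_has_sum) (auto simp: summable_sums)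
  from has_sum_product_mult[OF this _ has_sum_infsum[OF weight_summable]]
  have "((\<lambda>(k, v). cmod (c k) * weight v) has_sum ((\<Sum>k. cmod (c k)) * infsum weight UNIV)) UNIV"
    by simp
  hence "((\<lambda>j. case enum j of (k, v) \<Rightarrow> cmod (c k) * weight v) has_sum ((\<Sum>k. cmod (c k)) * infsum weight UNIV)) UNIV"
    by (subst has_sum_reindex_bij_betw[OF bij_enum])
  hence "(\<lambda>j. case enum j of (k, v) \<Rightarrow> cmod (c k) * weight v) sums ((\<Sum>k. cmod (c k)) * infsum weight UNIV)"
    by (rule has_sum_imp_sums)
  moreover have "cmod (mean_coeff j) = (case enum j of (k, v) \<Rightarrow> cmod (c k) * weight v)" for j
    by (simp add: mean_coeff_def norm_mult split: prod.split)
  ultimately show ?thesis by simp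
qed

text \<open>All three claims come from a single exchange of sum and integral: the integrand is
  expanded over pairs (k, v) into pieces of the k-th block on shells around 0, whose L^1 norms are
  dominated by the coefficients times |x|^(-\<beta>).\<close>

lemma
  fixes x :: "'p padic"
  assumes x: "x \<noteq> 0"
  shows integrable_HLP: "integrable M (\<lambda>y. f y / of_real (max (padic_norm x) (padic_norm y)))"
    and HLP_sums: "(\<lambda>j. mean_coeff j * mean_block j x) sums HLP_operator \<mu> f x"
    and norm_HLP_le: "cmod (HLP_operator \<mu> f x)
      \<le> (\<Sum>k. cmod (c k)) * infsum weight UNIV * padic_norm x powr (- \<beta>)"
proof -
  define e where "e = padic_exponent x"
  define G where "G y = (\<lambda>(k, v). c k * of_real (kernel v x) * (of_real (indicator (shell (e + v)) y) * a k y))" for y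
  define F where "F j y = G y (enum j)" for j y
  define B where "B j = cmod (mean_coeff j) * p powr (- real_of_int e * \<beta>)" for j
  define g where "g y = f y / of_real (max (padic_norm x) (padic_norm y))" for y
  have int: "integrable M (F j)" for j
    unfolding F_def G_def case_prod_beta by (intro integrable_mult_right shell_integrable blocks)
  have F_integral: "integral\<^sup>L M (F j) = mean_coeff j * mean_block j x" for j
  proof -
    obtain k v where kv: "enum j = (k, v)" by fastforce
    have "integral\<^sup>L M (F j) = c k * (of_real (kernel v x) * shell_integral (e + v) (a k))"
      unfolding F_def G_def kv shell_integral_def using shell_integrable[OF blocks(2)] by (simp add: mult.assoc)
    thus ?thesis unfolding e_def kernel_shell_integral by (simp add: mean_coeff_def mean_block_def kv)
  qed
  have F_norm: "(\<integral>y. cmod (F j y) \<partial>M) \<le> B j" for j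
  proof -
    obtain k v where kv: "enum j = (k, v)" by fastforce
    have "(\<integral>y. cmod (F j y) \<partial>M) = cmod (c k) * kernel v x * (\<integral>y. indicator (shell (e + v)) y * cmod (a k y) \<partial>M)"
      unfolding F_def G_def kv by (simp add: norm_mult)
    also have "\<dots> \<le> cmod (c k) * kernel v x * p powr (real_of_int (e + v) * (1 - \<beta>))"
      by (intro mult_left_mono block_shell_bound[OF blocks(1)]) simp
    also have "\<dots> = B j"
      unfolding mult.assoc e_def kernel_shell_bound by (simp add: B_def mean_coeff_def kv norm_mult e_def)
    finally show ?thesis .
  qed
  have B_sums: "B sums ((\<Sum>k. cmod (c k)) * infsum weight UNIV * p powr (- real_of_int e * \<beta>))"
    unfolding B_def by (intro sums_mult2 mean_coeff_sums)
  \<comment> \<open>Measurability of f is an assumption of the locale: an almost everywhere limit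
    need not be Borel measurable.\<close>
  have g_meas: "g \<in> borel_measurable M" unfolding g_def by measurable
  have lim: "AE y in M. summable (\<lambda>j. norm (F j y)) \<longrightarrow> (\<Sum>j. F j y) = g y"
  proof -
    have "AE y in M. (\<lambda>k. c k * a k y) sums f y" using dec by (simp add: block_decomposition_def)
    moreover have "AE y in M. y \<in> space M" by (rule AE_space)
    ultimately show ?thesis
    proof eventually_elim
      case (elim y)
      hence y: "y \<noteq> 0" by simp
      define v0 where "v0 = padic_exponent y - e"
      show ?case
      proof
        \<comment> \<open>Absolute summability turns the enumerated series into an unordered sum,
          which may be restricted to the pairs \<open>(k, v0)\<close>, the only ones whose shell
          contains y. What remains is the given series for f(y), scaled by the kernel.\<close>
        assume "summable (\<lambda>j. norm (F j y))"
        hence "((\<lambda>j. F j y) has_sum (\<Sum>j. F j y)) UNIV"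
          by (intro norm_summable_imp_has_sum) (auto intro: summable_sums summable_norm_cancel)
        hence "(G y has_sum (\<Sum>j. F j y)) UNIV"
          unfolding F_def by (subst (asm) has_sum_reindex_bij_betw[OF bij_enum])
        hence "(G y has_sum (\<Sum>j. F j y)) (range (\<lambda>k. (k, v0)))"
          by (rule has_sum_cong_neutral[THEN iffD1, rotated -1])
             (auto simp: G_def shell_def v0_def image_iff indicator_def)
        hence "((\<lambda>k. G y (k, v0)) has_sum (\<Sum>j. F j y)) UNIV"
          by (subst (asm) has_sum_reindex) (auto simp: inj_def o_def)
        hence "(\<lambda>k. G y (k, v0)) sums (\<Sum>j. F j y)" by (rule has_sum_imp_sums)
        moreover have "G y (k, v0) = of_real (kernel v0 x) * (c k * a k y)" for k
          using y by (simp add: G_def shell_def v0_def)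
        ultimately have "(\<lambda>k. of_real (kernel v0 x) * (c k * a k y)) sums (\<Sum>j. F j y)" by simp
        moreover have "(\<lambda>k. of_real (kernel v0 x) * (c k * a k y)) sums (of_real (kernel v0 x) * f y)"
          using elim by (intro sums_mult) simp
        ultimately have "(\<Sum>j. F j y) = of_real (kernel v0 x) * f y" by (rule sums_unique2)
        also have "\<dots> = g y"
          using inverse_max_eq_kernel[OF x y]
          by (simp add: g_def v0_def e_def divide_inverse mult.commute flip: of_real_inverse)
        finally show "(\<Sum>j. F j y) = g y" .
      qed
    qed
  qed
  note T = sums_integral_Tonelli[OF int F_norm sums_summable[OF B_sums] g_meas lim]
  show "integrable M (\<lambda>y. f y / of_real (max (padic_norm x) (padic_norm y)))"
    using T(1) by (simp add: g_def)
  have H: "HLP_operator \<mu> f x = integral\<^sup>L M g" by (simp add: HLP_operator_def g_def[abs_def])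
  show sums: "(\<lambda>j. mean_coeff j * mean_block j x) sums HLP_operator \<mu> f x"
    using T(2) by (simp add: F_integral H)
  have "cmod (HLP_operator \<mu> f x) = cmod (\<Sum>j. integral\<^sup>L M (F j))"
    unfolding H using sums_unique[OF T(2)] by simp
  also have "\<dots> \<le> (\<Sum>j. B j)"
    by (rule norm_suminf_le) (auto intro: order_trans[OF integral_norm_bound F_norm] sums_summable[OF B_sums])
  also have "\<dots> = (\<Sum>k. cmod (c k)) * infsum weight UNIV * padic_norm x powr (- \<beta>)"
    using sums_unique[OF B_sums] x by (simp add: padic_norm_eq_powr powr_powr e_def)
  finally show "cmod (HLP_operator \<mu> f x)
      \<le> (\<Sum>k. cmod (c k)) * infsum weight UNIV * padic_norm x powr (- \<beta>)" .
qed

section \<open>The image as an element of the block space\<close>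

lemma HLP_block_decomposition: "block_decomposition \<mu> r \<alpha> (HLP_operator \<mu> f) mean_coeff mean_block"
proof -
  have "central_block \<mu> r \<alpha> (mean_block j)" for j
    unfolding mean_block_def using central_block_dilation_mean[OF blocks(1)] by (simp split: prod.split)
  moreover have "AE x in M. (\<lambda>j. mean_coeff j * mean_block j x) sums HLP_operator \<mu> f x"
    by (rule AE_I2) (use HLP_sums in simp)
  ultimately show ?thesis
    using sums_summable[OF mean_coeff_sums] by (simp add: block_decomposition_def)
qed

text \<open>The series converges at every nonzero x, so the image is a genuine pointwise limit of
  measurable functions.\<close>

lemma measurable_HLP [measurable]: "HLP_operator \<mu> f \<in> borel_measurable M"
proof -
  have [measurable]: "mean_block j \<in> borel_measurable M" for j
    unfolding mean_block_def by (simp split: prod.split)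
  show ?thesis
  proof (rule borel_measurable_LIMSEQ_metric)
    show "(\<lambda>x. \<Sum>j<n. mean_coeff j * mean_block j x) \<in> borel_measurable M" for n by measurable
    show "(\<lambda>n. \<Sum>j<n. mean_coeff j * mean_block j x) \<longlonglongrightarrow> HLP_operator \<mu> f x" if "x \<in> space M" for x
      using HLP_sums[of x] that by (simp add: sums_def)
  qed
qed

text \<open>On a nonempty compact K avoiding 0 the norm attains a positive minimum, which makes the
  bound |x|^(-\<beta>) uniform, and a maximum, which places K in a ball of finite measure.\<close>

lemma HLP_in_Lr_loc: "HLP_operator \<mu> f \<in> Lr_loc_star \<mu> r"
proof -
  have "in_Lr M r (\<lambda>x. indicator K x * HLP_operator \<mu> f x)" if K: "compact K" "K \<subseteq> - {0}" for K
  proof (cases "K = {}")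
    case True
    thus ?thesis by (simp add: in_Lr_def)
  next
    case False
    obtain x0 where x0: "x0 \<in> K" "\<And>x. x \<in> K \<Longrightarrow> padic_norm x0 \<le> padic_norm x"
      using continuous_attains_inf[OF K(1) False continuous_on_padic_norm] by blast
    obtain x1 where x1: "x1 \<in> K" "\<And>x. x \<in> K \<Longrightarrow> padic_norm x \<le> padic_norm x1"
      using continuous_attains_sup[OF K(1) False continuous_on_padic_norm] by blast
    have x0_pos: "padic_norm x0 > 0" using x0(1) K(2) by (auto simp: less_le)
    have "x1 \<noteq> 0" using x1(1) K(2) by auto
    hence "K \<subseteq> padic_ball (padic_exponent x1) - {0}"
      using x1(2) K(2) by (auto simp: padic_ball_def padic_norm_eq_powi)
    from emeasure_M_le_ball[OF this] have fin: "emeasure M K < \<infinity>" by (auto intro: le_less_trans)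
    \<comment> \<open>The transfer from the Borel sets to the punctured space is available for
      functions, so K passes through its indicator.\<close>
    have "(\<lambda>x. indicator K x :: real) \<in> borel_measurable M"
      using compact_imp_closed[OF K(1)] by (intro measurable_M borel_measurable_indicator borel_closed)
    hence [measurable]: "K \<in> sets M"
      using K(2) by (simp add: borel_measurable_indicator_iff Int_absorb2)
    define T where "T = (\<Sum>k. cmod (c k)) * infsum weight UNIV * padic_norm x0 powr (- \<beta>)"
    have D0: "0 \<le> (\<Sum>k. cmod (c k)) * infsum weight UNIV"
      using dec by (auto simp: block_decomposition_def intro!: mult_nonneg_nonneg suminf_nonneg infsum_nonneg)
    have le: "cmod (HLP_operator \<mu> f x) \<le> T" if "x \<in> K" for x
    proof -
      have "x \<noteq> 0" using that K(2) by auto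
      moreover have "padic_norm x powr (- \<beta>) \<le> padic_norm x0 powr (- \<beta>)"
        using x0(2)[OF that] x0_pos \<beta>_bounds by (intro powr_mono2') auto
      ultimately show ?thesis
        using norm_HLP_le[of x] mult_left_mono[OF _ D0] unfolding T_def by (meson order_trans)
    qed
    have "integrable M (\<lambda>x. T powr r * indicator K x)" using fin K(2) by (simp add: integrable_indicator_iff Int_absorb2)
    hence "integrable M (\<lambda>x. cmod (indicator K x * HLP_operator \<mu> f x) powr r)"
      by (rule Bochner_Integration.integrable_bound)
         (use le r in \<open>auto simp: indicator_def intro!: powr_mono2\<close>)
    thus ?thesis by (simp add: in_Lr_def)
  qed
  thus ?thesis by (auto simp: Lr_loc_star_def)
qed

lemma block_norm_HLP_le:
  "block_norm \<mu> r \<alpha> (HLP_operator \<mu> f) \<le> infsum weight UNIV * (\<Sum>k. cmod (c k))"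
proof -
  have "block_norm \<mu> r \<alpha> (HLP_operator \<mu> f) \<le> (\<Sum>j. cmod (mean_coeff j))"
    unfolding block_norm_def
  proof (rule cInf_lower)
    show "bdd_below {\<Sum>k. cmod (c k) |c. \<exists>a. block_decomposition \<mu> r \<alpha> (HLP_operator \<mu> f) c a}"
      by (rule bdd_belowI[of _ 0]) (auto simp: block_decomposition_def intro: suminf_nonneg)
  qed (use HLP_block_decomposition in blast)
  thus ?thesis using sums_unique[OF mean_coeff_sums] by (simp add: mult.commute)
qed

end

text \<open>The shift v = 0 alone has weight 1.\<close>

lemma (in block_exponents) infsum_weight_pos: "0 < infsum weight UNIV"
proof -
  have "sum weight {0} \<le> infsum weight UNIV"
    by (rule finite_sum_le_infsum[OF weight_summable]) auto
  thus ?thesis using p_gt_1 by (simp add: weight_def)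
qed

text \<open>A Bochner integral of a nonintegrable function is 0 and \<open>Inf\<close> of the empty
  set is an unspecified real. Integrability at every nonzero x and membership of the image rule out
  both defaults, so that the norm inequality has its intended meaning.\<close>

theorem mainTheorem6:
  fixes \<mu> :: "'p::prime_card padic measure" and r \<alpha> :: real
  assumes "normalized_haar \<mu>"
    and "1 < r" and "0 < \<alpha>"
    and "0 < 1 / r + \<alpha>" and "1 / r + \<alpha> < 1"
  shows "\<exists>C>0. \<forall>f\<in>block_space \<mu> r \<alpha>.
    (\<forall>x :: 'p padic. x \<noteq> 0 \<longrightarrow> integrable (padic_star \<mu>) (\<lambda>y. f y / of_real (max (padic_norm x) (padic_norm y)))) \<and>
    HLP_operator \<mu> f \<in> block_space \<mu> r \<alpha> \<and>
    block_norm \<mu> r \<alpha> (HLP_operator \<mu> f) \<le> C * block_norm \<mu> r \<alpha> f"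
proof -
  interpret block_exponents \<mu> "real CARD('p)" r \<alpha>
    by unfold_locales (use assms in auto)
  let ?C = "infsum weight UNIV"
  show ?thesis
  proof (intro exI[of _ ?C] conjI ballI allI impI infsum_weight_pos)
    fix f assume "f \<in> block_space \<mu> r \<alpha>"
    then obtain c a where f: "f \<in> borel_measurable (padic_star \<mu>)" and dec: "block_decomposition \<mu> r \<alpha> f c a"
      by (auto simp: block_space_def Lr_loc_star_def)
    interpret block_sum \<mu> "real CARD('p)" r \<alpha> f c a
      by unfold_locales (use f dec in auto)
    show "integrable (padic_star \<mu>) (\<lambda>y. f y / of_real (max (padic_norm x) (padic_norm y)))"
      if "x \<noteq> 0" for x :: "'p padic"
      by (rule integrable_HLP[OF that])
    show "HLP_operator \<mu> f \<in> block_space \<mu> r \<alpha>"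
      using HLP_in_Lr_loc HLP_block_decomposition unfolding block_space_def by blast
    \<comment> \<open>Dividing by the constant reduces the claim to a lower bound valid for every
      decomposition of f.\<close>
    have "block_norm \<mu> r \<alpha> (HLP_operator \<mu> f) / ?C \<le> block_norm \<mu> r \<alpha> f"
      unfolding block_norm_def[of \<mu> r \<alpha> f]
    proof (rule cInf_greatest)
      show "{\<Sum>k. cmod (c k) |c. \<exists>a. block_decomposition \<mu> r \<alpha> f c a} \<noteq> {}" using dec by blast
      fix s assume "s \<in> {\<Sum>k. cmod (c k) |c. \<exists>a. block_decomposition \<mu> r \<alpha> f c a}"
      then obtain c' a' where s: "s = (\<Sum>k. cmod (c' k))" and dec': "block_decomposition \<mu> r \<alpha> f c' a'" by blast
      \<comment> \<open>The operator is applied to f itself, so a second decomposition bounds the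
        norm of the same image with the same constant.\<close>
      interpret other: block_sum \<mu> "real CARD('p)" r \<alpha> f c' a'
        by unfold_locales (use f dec' in auto)
      show "block_norm \<mu> r \<alpha> (HLP_operator \<mu> f) / ?C \<le> s"
        using other.block_norm_HLP_le infsum_weight_pos by (simp add: s field_simps)
    qed
    thus "block_norm \<mu> r \<alpha> (HLP_operator \<mu> f) \<le> ?C * block_norm \<mu> r \<alpha> f"
      using infsum_weight_pos by (simp add: field_simps)
  qed
qed

end
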